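(* Let $\mathbb{F}$ be a field and let $J\in M_{n}(\mathbb{F})$ be a nonsingular Jordan matrix with at least two distinct eigenvalues and such that $\mathrm{tr}(J)=0$. If $J$ is a nondiagonal matrix whose spectrum contains neither $1$ nor $-1$, or if $J$ is a diagonal matrix, then $J$ verifies the $(U,L)$-property.
   Context: $M_n(\mathbb{F})$ is the algebra of $n\times n$ matrices over the field $\mathbb{F}$, and $\mathrm{tr}$ is the trace. For $\lambda\in\mathbb{F}$, the $k\times k$ Jordan block $J_k(\lambda)$ is the matrix with $\lambda$ in every diagonal entry, $1$ in every superdiagonal entry, and $0$ elsewhere ($J_1(\lambda)=[\lambda]$). A Jordan matrix over $\mathbb{F}$ is any block diagonal matrix whose diagonal blocks are Jordan blocks over $\mathbb{F}$. A matrix $A\in M_n(\mathbb{F})$ verifies the $(U,L)$-property if $A$ is similar (over $\mathbb{F}$) to a matrix $G\in M_n(\mathbb{F})$ whose diagonal entries are all equal to zero, and whose superdiagonal entries (positions $(i,i+1)$) and subdiagonal entries (positions $(i+1,i)$) are all nonzero. *)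

theory Defs
  imports "Jordan_Normal_Form.Jordan_Normal_Form" "Jordan_Normal_Form.Spectral_Radius"
begin

definition mat_trace :: "'a :: comm_monoid_add mat \<Rightarrow> 'a" where
  "mat_trace A = (\<Sum>i<dim_row A. A $$ (i, i))"

text \<open>Blocks of size 0, which \<^const>\<open>jordan_matrix\<close> would accept, are excluded.\<close>

definition is_jordan_matrix :: "'a :: {zero, one} mat \<Rightarrow> bool" where
  "is_jordan_matrix J \<longleftrightarrow> (\<exists>n_as. 0 \<notin> fst ` set n_as \<and> J = jordan_matrix n_as)"

definition UL_property :: "'a :: field mat \<Rightarrow> bool" where
  "UL_property A \<longleftrightarrow>
     (\<exists>G. similar_mat A G \<and>
          (\<forall>i < dim_row G. G $$ (i, i) = 0) \<and>
          (\<forall>i. Suc i < dim_row G \<longrightarrow> G $$ (i, Suc i) \<noteq> 0 \<and> G $$ (Suc i, i) \<noteq> 0))"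

end

(* A zero-diagonal matrix with nonzero sub- and superdiagonal is built one row and column at a time.
   One proves by induction on n a pointed version of the claim: given also a column c and a row r,
   the similarity can be chosen so that the first entries of the transformed c and r are nonzero;
   c and r are what remains of the previously split off column and row.

   If the field has at least four elements, this works for every trace-zero A that is not scalar and
   has rank at least two. Choose a non-eigenvector v and a basis starting with v, A v; then A has
   first column e_1, and conjugating by 1 + e_0 t^T alters the trailing block only in its first row.
   All requirements on t are nonvanishing conditions for at most four linear functionals (one of them
   homogenizes), and four hyperplanes do not cover F^n.

   A smaller field has only the eigenvalues 1 and -1 to offer, which must be distinct, so F has three
   elements and J is diagonal. Its entries then split into pairs (1, -1) and triples (a, a, a), and
   each of these, bordered by a zero, is similar to an explicit 3x3 or 4x4 matrix of the desired
   shape. *)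

theory Submission
  imports Defs
begin

section \<open>Pointed similarity and splitting off a row and a column\<close>

definition zero_diag_adj_nonzero :: "'a :: field mat \<Rightarrow> bool" where
  "zero_diag_adj_nonzero G \<longleftrightarrow> (\<forall>i < dim_row G. G $$ (i, i) = 0) \<and>
     (\<forall>i. Suc i < dim_row G \<longrightarrow> G $$ (i, Suc i) \<noteq> 0 \<and> G $$ (Suc i, i) \<noteq> 0)"

text \<open>The column \<open>c\<close> and the row \<open>r\<close> are to border \<open>A\<close> from above and from the left.\<close>

definition rooted :: "nat \<Rightarrow> 'a :: field mat \<Rightarrow> 'a vec \<Rightarrow> 'a vec \<Rightarrow> bool" where
  "rooted n A c r \<longleftrightarrow> (\<exists>P Q. P \<in> carrier_mat n n \<and> Q \<in> carrier_mat n n \<and> P * Q = 1\<^sub>m n \<and> Q * P = 1\<^sub>m n \<and>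
     zero_diag_adj_nonzero (Q * A * P) \<and> (Q *\<^sub>v c) $ 0 \<noteq> 0 \<and> r \<bullet> col P 0 \<noteq> 0)"

lemma rooted_imp_UL_property:
  assumes "A \<in> carrier_mat n n" "rooted n A c r"
  shows "UL_property A"
proof -
  obtain P Q where PQ: "P \<in> carrier_mat n n" "Q \<in> carrier_mat n n" "P * Q = 1\<^sub>m n" "Q * P = 1\<^sub>m n"
    "zero_diag_adj_nonzero (Q * A * P)" using assms(2) unfolding rooted_def by blast
  have "A = P * (Q * A * P) * Q"
  proof -
    have "P * (Q * A * P) * Q = (P * Q) * A * (P * Q)"
      using PQ(1,2) assms(1) by (simp add: assoc_mult_mat[of _ n n _ n _ n])
    then show ?thesis using PQ assms(1) by simp
  qed
  then have "similar_mat A (Q * A * P)"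
    unfolding similar_mat_def using PQ assms(1) by (intro exI[of _ P] exI[of _ Q] similar_mat_witI[of _ _ n]) auto
  then show ?thesis using PQ(5) unfolding UL_property_def zero_diag_adj_nonzero_def by blast
qed

lemma scalar_prod_transpose_mult_vec:
  fixes A :: "'a :: comm_semiring_0 mat"
  assumes "A \<in> carrier_mat n m" "x \<in> carrier_vec n" "y \<in> carrier_vec m"
  shows "(transpose_mat A *\<^sub>v x) \<bullet> y = x \<bullet> (A *\<^sub>v y)"
  using assoc_scalar_prod[OF _ _ _] assms 
  by (metis transpose_vec_mult_scalar comm_scalar_prod mult_mat_vec_carrier transpose_carrier_mat)

text \<open>Change of basis for the pointed claim: \<open>T\<close> acts on columns and its
  transpose pulls rows back, so the pairing of a row with a column is unchanged. If \<open>P\<close>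
  and \<open>Q\<close> serve for \<open>A'\<close>, then \<open>S * P\<close> and
  \<open>Q * T\<close> serve for \<open>A\<close>.\<close>

lemma rooted_conj:
  assumes A: "A \<in> carrier_mat n n" and A': "A' \<in> carrier_mat n n"
    and S: "S \<in> carrier_mat n n" and T: "T \<in> carrier_mat n n" and ST: "S * T = 1\<^sub>m n" "T * S = 1\<^sub>m n"
    and eq: "T * A = A' * T" and c: "c \<in> carrier_vec n" and r': "r' \<in> carrier_vec n"
    and r: "r = transpose_mat T *\<^sub>v r'"
    and rt: "rooted n A' (T *\<^sub>v c) r'" and n: "n > 0"
  shows "rooted n A c r"
proof -
  obtain P Q where PQ: "P \<in> carrier_mat n n" "Q \<in> carrier_mat n n" "P * Q = 1\<^sub>m n" "Q * P = 1\<^sub>m n"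
    "zero_diag_adj_nonzero (Q * A' * P)" "(Q *\<^sub>v (T *\<^sub>v c)) $ 0 \<noteq> 0" "r' \<bullet> col P 0 \<noteq> 0"
    using rt unfolding rooted_def by blast
  have 1: "(S * P) * (Q * T) = 1\<^sub>m n"
  proof -
    have "(S * P) * (Q * T) = S * (P * Q) * T"
      using PQ(1,2) S T by (simp add: assoc_mult_mat[of _ n n _ n _ n])
    then show ?thesis using PQ ST S T by simp
  qed
  have 2: "(Q * T) * (S * P) = 1\<^sub>m n"
  proof -
    have "(Q * T) * (S * P) = Q * (T * S) * P"
      using PQ(1,2) S T by (simp add: assoc_mult_mat[of _ n n _ n _ n])
    then show ?thesis using PQ ST S T by simp
  qed
  have 3: "(Q * T) * A * (S * P) = Q * A' * P"
  proof -
    have "(Q * T) * A * (S * P) = Q * (T * A) * (S * P)"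
      using PQ(1,2) S T A by (simp add: assoc_mult_mat[of _ n n _ n _ n])
    also have "\<dots> = Q * A' * (T * S) * P"
      unfolding eq using PQ(1,2) S T A' by (simp add: assoc_mult_mat[of _ n n _ n _ n])
    finally show ?thesis using PQ ST S T A' by simp
  qed
  have 4: "Q * T *\<^sub>v c = Q *\<^sub>v (T *\<^sub>v c)" using PQ T c by (simp add: assoc_mult_mat_vec)
  have "r \<bullet> col (S * P) 0 = r' \<bullet> (T *\<^sub>v (S *\<^sub>v col P 0))"
    unfolding r col_mult2[OF S PQ(1) n]
    by (rule scalar_prod_transpose_mult_vec[OF T r']) (intro mult_mat_vec_carrier[OF S] col_carrier_vec[OF n PQ(1)])
  also have "T *\<^sub>v (S *\<^sub>v col P 0) = col P 0"
    using PQ S T ST n by (metis assoc_mult_mat_vec col_carrier_vec one_mult_mat_vec col_dim carrier_matD(1))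
  finally show ?thesis unfolding rooted_def
    using 1 2 3 4 PQ S T by (intro exI[of _ "S * P"] exI[of _ "Q * T"]) auto
qed

definition trailing :: "'a mat \<Rightarrow> 'a mat" where
  "trailing A = mat (dim_row A - 1) (dim_col A - 1) (\<lambda>(i, j). A $$ (Suc i, Suc j))"

definition trailing_col :: "'a mat \<Rightarrow> 'a vec" where
  "trailing_col A = vec (dim_row A - 1) (\<lambda>i. A $$ (Suc i, 0))"

definition trailing_row :: "'a mat \<Rightarrow> 'a vec" where
  "trailing_row A = vec (dim_col A - 1) (\<lambda>i. A $$ (0, Suc i))"

lemma trailing_carrier [simp]: "A \<in> carrier_mat (Suc m) (Suc m) \<Longrightarrow> trailing A \<in> carrier_mat m m"
  "A \<in> carrier_mat (Suc m) (Suc m) \<Longrightarrow> trailing_col A \<in> carrier_vec m"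
  "A \<in> carrier_mat (Suc m) (Suc m) \<Longrightarrow> trailing_row A \<in> carrier_vec m"
  by (auto simp: trailing_def trailing_col_def trailing_row_def)

definition bordered :: "'a::{zero,one} mat \<Rightarrow> 'a mat" where
  "bordered P = mat (Suc (dim_row P)) (Suc (dim_col P))
     (\<lambda>(i, j). if i = 0 \<or> j = 0 then (if i = j then 1 else 0) else P $$ (i - 1, j - 1))"

lemma bordered_carrier [simp]: "P \<in> carrier_mat m m \<Longrightarrow> bordered P \<in> carrier_mat (Suc m) (Suc m)"
  by (auto simp: bordered_def)

lemma bordered_mult:
  fixes P :: "'a :: semiring_1 mat"
  assumes "P \<in> carrier_mat m m" "Q \<in> carrier_mat m m"
  shows "bordered P * bordered Q = bordered (P * Q)"
proof (rule eq_matI)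
  fix i j assume ij: "i < dim_row (bordered (P * Q))" "j < dim_col (bordered (P * Q))"
  then have "i < Suc m" "j < Suc m" using assms by (auto simp: bordered_def)
  then show "(bordered P * bordered Q) $$ (i, j) = bordered (P * Q) $$ (i, j)" using assms
    by (cases i; cases j) (auto simp: bordered_def scalar_prod_def sum.lessThan_Suc_shift atLeast0LessThan simp del: sum.lessThan_Suc sum.op_ivl_Suc)
qed (use assms in \<open>auto simp: bordered_def\<close>)

lemma bordered_one: "bordered (1\<^sub>m m) = 1\<^sub>m (Suc m)"
  by (rule eq_matI) (auto simp: bordered_def)

text \<open>Conjugation by the direct sum of 1 and \<open>P\<close> fixes the corner and turns the
  two entries next to it into \<open>trailing_row A \<bullet> col P 0\<close> and
  \<open>(Q *\<^sub>v trailing_col A) $ 0\<close>. Their nonvanishing is exactly the pointed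
  condition on the trailing block. The first entries of \<open>c\<close> and \<open>r\<close> do not
  change, so the condition is passed on to the larger matrix.\<close>

lemma rooted_peel:
  assumes A: "A \<in> carrier_mat (Suc m) (Suc m)" and A00: "A $$ (0, 0) = 0"
    and c: "c \<in> carrier_vec (Suc m)" "c $ 0 \<noteq> 0" and r: "r \<in> carrier_vec (Suc m)" "r $ 0 \<noteq> 0"
    and rt: "rooted m (trailing A) (trailing_col A) (trailing_row A)"
  shows "rooted (Suc m) A c r"
proof -
  obtain P Q where PQ: "P \<in> carrier_mat m m" "Q \<in> carrier_mat m m" "P * Q = 1\<^sub>m m" "Q * P = 1\<^sub>m m"
    "zero_diag_adj_nonzero (Q * trailing A * P)" "(Q *\<^sub>v trailing_col A) $ 0 \<noteq> 0" "trailing_row A \<bullet> col P 0 \<noteq> 0"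
    using rt unfolding rooted_def by blast
  let ?P = "bordered P" and ?Q = "bordered Q"
  have QA: "(?Q * A) $$ (i, j) = (if i = 0 then A $$ (0, j) else \<Sum>k<m. Q $$ (i - 1, k) * A $$ (Suc k, j))"
    if "i < Suc m" "j < Suc m" for i j
    using that A PQ(2) by (cases i) (auto simp: bordered_def scalar_prod_def sum.lessThan_Suc_shift atLeast0LessThan simp del: sum.lessThan_Suc sum.op_ivl_Suc)
  have MP: "(M * ?P) $$ (i, j) = (if j = 0 then M $$ (i, 0) else \<Sum>k<m. M $$ (i, Suc k) * P $$ (k, j - 1))"
    if "i < Suc m" "j < Suc m" "M \<in> carrier_mat (Suc m) (Suc m)" for M i j
    using that PQ(1) by (cases j) (auto simp: bordered_def scalar_prod_def sum.lessThan_Suc_shift atLeast0LessThan simp del: sum.lessThan_Suc sum.op_ivl_Suc)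
  have "?Q * A \<in> carrier_mat (Suc m) (Suc m)" using A PQ(2) by (meson bordered_carrier mult_carrier_mat)
  note G = MP[OF _ _ this]
  have inner: "(?Q * A * ?P) $$ (Suc i, Suc j) = (Q * trailing A * P) $$ (i, j)" if "i < m" "j < m" for i j
    using that A PQ(1,2) by (simp add: G QA scalar_prod_def trailing_def atLeast0LessThan)
  have G00: "(?Q * A * ?P) $$ (0, 0) = 0" using A00 by (simp add: G QA)
  have G01: "(?Q * A * ?P) $$ (0, Suc 0) = trailing_row A \<bullet> col P 0" if "m > 0"
    using that A PQ(1,2) by (simp add: G QA scalar_prod_def trailing_row_def atLeast0LessThan)
  have G10: "(?Q * A * ?P) $$ (Suc 0, 0) = (Q *\<^sub>v trailing_col A) $ 0" if "m > 0"
    using that A PQ(1,2) by (simp add: G QA scalar_prod_def trailing_col_def atLeast0LessThan)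
  have dims: "dim_row (?Q * A * ?P) = Suc m" "dim_row (Q * trailing A * P) = m" using A PQ by (auto simp: bordered_def)
  have z: "zero_diag_adj_nonzero (?Q * A * ?P)"
    unfolding zero_diag_adj_nonzero_def dims
  proof (intro conjI allI impI)
    fix i assume "i < Suc m"
    then show "(?Q * A * ?P) $$ (i, i) = 0"
      using G00 inner PQ(5) dims unfolding zero_diag_adj_nonzero_def by (cases i) auto
  next
    fix i assume i: "Suc i < Suc m"
    show "(?Q * A * ?P) $$ (i, Suc i) \<noteq> 0"
      using G01 inner PQ(5,7) i dims unfolding zero_diag_adj_nonzero_def by (cases i) auto
    show "(?Q * A * ?P) $$ (Suc i, i) \<noteq> 0"
      using G10 inner PQ(5,6) i dims unfolding zero_diag_adj_nonzero_def by (cases i) auto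
  qed
  have c0: "(?Q *\<^sub>v c) $ 0 \<noteq> 0"
    using PQ(2) c by (auto simp: bordered_def scalar_prod_def sum.lessThan_Suc_shift atLeast0LessThan simp del: sum.lessThan_Suc sum.op_ivl_Suc)
  have r0: "r \<bullet> col ?P 0 \<noteq> 0"
    using PQ(1) r by (auto simp: bordered_def scalar_prod_def sum.lessThan_Suc_shift atLeast0LessThan simp del: sum.lessThan_Suc sum.op_ivl_Suc)
  show ?thesis unfolding rooted_def
    by (intro exI[of _ ?P] exI[of _ ?Q]) (use PQ(1-4) z c0 r0 in \<open>auto simp: bordered_mult bordered_one\<close>)
qed

section \<open>Fields with at least four elements\<close>

text \<open>The hypothesis \<open>big\<close> expresses that the field has at least four elements in
  a way that also covers infinite fields, whose \<open>card\<close> is 0. If \<open>f\<close>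
  vanishes at \<open>v\<close>, move along the line \<open>v + t w\<close> with \<open>f\<close>
  nonzero at \<open>w\<close>: each functional excludes at most one value of
  \<open>t\<close>.\<close>

lemma common_nonvanishing_insert:
  fixes S :: "'a :: field vec set"
  assumes big: "\<And>T :: 'a set. finite T \<Longrightarrow> card T \<le> 3 \<Longrightarrow> T \<noteq> UNIV"
    and S: "finite S" "card S \<le> 3" "S \<subseteq> carrier_vec n"
    and v: "v \<in> carrier_vec n" "\<And>g. g \<in> S \<Longrightarrow> g \<bullet> v \<noteq> 0"
    and f: "f \<in> carrier_vec n" "f \<noteq> 0\<^sub>v n"
  shows "\<exists>v \<in> carrier_vec n. \<forall>g \<in> insert f S. g \<bullet> v \<noteq> 0"
proof (cases "f \<bullet> v = 0")
  case False then show ?thesis using v by auto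
next
  case True
  obtain i where i: "i < n" "f $ i \<noteq> 0" using f by (metis eq_vecI carrier_vecD index_zero_vec)
  define w :: "'a vec" where "w = unit_vec n i"
  have w: "w \<in> carrier_vec n" "f \<bullet> w \<noteq> 0" using i f by (auto simp: w_def)
  show ?thesis
  proof (cases "\<forall>g\<in>S. g \<bullet> w \<noteq> 0")
    case True then show ?thesis using w by auto
  next
    case False
    then obtain g0 where g0: "g0 \<in> S" "g0 \<bullet> w = 0" by auto
    \<comment> \<open>The value 0 is excluded on behalf of \<open>f\<close>, which vanishes at
      \<open>v\<close>. The functional \<open>g0\<close> is constant along the line and excludes
      nothing, so at most two further values remain to be avoided.\<close>
    define T where "T = insert 0 ((\<lambda>g. - (g \<bullet> v) / (g \<bullet> w)) ` (S - {g0}))"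
    have "card (S - {g0}) \<le> 2" using S g0 by simp
    then have "card ((\<lambda>g. - (g \<bullet> v) / (g \<bullet> w)) ` (S - {g0})) \<le> 2"
      using card_image_le[of "S - {g0}"] S(1) by (meson finite_Diff le_trans)
    then have "card T \<le> 3" unfolding T_def
      using card_insert_le_m1[of 3 _ 0] by simp
    moreover have "finite T" using S by (simp add: T_def)
    ultimately obtain t where t: "t \<notin> T" using big by blast
    have "g \<bullet> (v + t \<cdot>\<^sub>v w) \<noteq> 0" if gS: "g \<in> insert f S" for g
    proof -
      have gc: "g \<in> carrier_vec n" using gS f S by auto
      have e: "g \<bullet> (v + t \<cdot>\<^sub>v w) = g \<bullet> v + t * (g \<bullet> w)"
        using gc v w by (simp add: scalar_prod_add_distrib[of _ n])
      have t0: "t \<noteq> 0" using t by (auto simp: T_def)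
      consider "g = f" | "g = g0" | "g \<in> S - {g0}" using gS by blast
      then show ?thesis
      proof cases
        case 1 then show ?thesis using e t0 w True by simp
      next
        case 2 then show ?thesis using e g0 v by simp
      next
        case 3
        then have "t \<noteq> - (g \<bullet> v) / (g \<bullet> w)" using t by (auto simp: T_def)
        then have "t * (g \<bullet> w) \<noteq> - (g \<bullet> v)" if "g \<bullet> w \<noteq> 0" using that by (simp add: field_simps)
        then show ?thesis using e v(2)[of g] 3
          by (cases "g \<bullet> w = 0") (auto simp: add_eq_0_iff)
      qed
    qed
    then show ?thesis using v w by (intro bexI[of _ "v + t \<cdot>\<^sub>v w"]) auto
  qed
qed

text \<open>The bound four cannot be raised: over the field with four elements, the five lines
  through the origin cover the plane.\<close>

lemma common_nonvanishing:
  fixes fs :: "'a :: field vec list"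
  assumes big: "\<And>T :: 'a set. finite T \<Longrightarrow> card T \<le> 3 \<Longrightarrow> T \<noteq> UNIV"
    and "length fs \<le> 4" "set fs \<subseteq> carrier_vec n" "0\<^sub>v n \<notin> set fs"
  shows "\<exists>v \<in> carrier_vec n. \<forall>g \<in> set fs. g \<bullet> v \<noteq> 0"
  using assms(2-)
proof (induction fs)
  case Nil then show ?case by (metis empty_iff list.set(1) zero_carrier_vec)
next
  case (Cons f fs)
  then obtain v where "v \<in> carrier_vec n" "\<forall>g \<in> set fs. g \<bullet> v \<noteq> 0" by auto
  moreover have "card (set fs) \<le> 3" using card_length[of fs] Cons.prems(1) by simp
  ultimately show ?case using Cons.prems
    common_nonvanishing_insert[OF big, of "set fs" n v f] by auto
qed

text \<open>If every vector off the hyperplanes of \<open>f\<close> and \<open>g\<close> is an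
  eigenvector, then all these vectors share one eigenvalue \<open>a\<close>. A nonzero row of
  \<open>A - a\<close> would give a third hyperplane, and three hyperplanes do not cover the
  space.\<close>

lemma nonscalar_noneigenvector:
  fixes A :: "'a :: field mat"
  assumes big: "\<And>T :: 'a set. finite T \<Longrightarrow> card T \<le> 3 \<Longrightarrow> T \<noteq> UNIV"
    and A: "A \<in> carrier_mat n n" "\<And>a. A \<noteq> a \<cdot>\<^sub>m 1\<^sub>m n"
    and f: "f \<in> carrier_vec n" "f \<noteq> 0\<^sub>v n" and g: "g \<in> carrier_vec n" "g \<noteq> 0\<^sub>v n"
  shows "\<exists>v \<in> carrier_vec n. f \<bullet> v \<noteq> 0 \<and> g \<bullet> v \<noteq> 0 \<and> (\<forall>a. A *\<^sub>v v \<noteq> a \<cdot>\<^sub>v v)"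
proof (rule ccontr)
  assume "\<not> ?thesis"
  then have ev: "\<exists>a. A *\<^sub>v v = a \<cdot>\<^sub>v v" if "v \<in> carrier_vec n" "f \<bullet> v \<noteq> 0" "g \<bullet> v \<noteq> 0" for v using that by blast
  obtain v where v: "v \<in> carrier_vec n" "f \<bullet> v \<noteq> 0" "g \<bullet> v \<noteq> 0"
    using common_nonvanishing[OF big, of "[f, g]" n] f g by auto
  obtain a where a: "A *\<^sub>v v = a \<cdot>\<^sub>v v" using ev v by blast
  have all: "A *\<^sub>v w = a \<cdot>\<^sub>v w" if w: "w \<in> carrier_vec n" "f \<bullet> w \<noteq> 0" "g \<bullet> w \<noteq> 0" for w
  proof -
    obtain b where b: "A *\<^sub>v w = b \<cdot>\<^sub>v w" using ev w by blast
    \<comment> \<open>The last two values are those at which \<open>f\<close> or \<open>g\<close>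
      vanishes on \<open>v + t w\<close>; all other \<open>t\<close> make this vector an eigenvector
      too.\<close>
    have "card {0, - (f \<bullet> v) / (f \<bullet> w), - (g \<bullet> v) / (g \<bullet> w)} \<le> 3" by (auto simp: card_insert_if)
    then obtain t where t: "t \<notin> {0, - (f \<bullet> v) / (f \<bullet> w), - (g \<bullet> v) / (g \<bullet> w)}" using big
      by (metis UNIV_eq_I finite.emptyI finite.insertI)
    let ?x = "v + t \<cdot>\<^sub>v w"
    have "f \<bullet> ?x = f \<bullet> v + t * (f \<bullet> w)" "g \<bullet> ?x = g \<bullet> v + t * (g \<bullet> w)"
      using f g v w by (simp_all add: scalar_prod_add_distrib[of _ n])
    moreover have "f \<bullet> v + t * (f \<bullet> w) \<noteq> 0" "g \<bullet> v + t * (g \<bullet> w) \<noteq> 0"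
      using t w by (auto simp: field_simps add_eq_0_iff)
    ultimately obtain d where d: "A *\<^sub>v ?x = d \<cdot>\<^sub>v ?x" using ev[of ?x] v w by auto
    have "A *\<^sub>v ?x = a \<cdot>\<^sub>v v + t \<cdot>\<^sub>v (b \<cdot>\<^sub>v w)"
      using A v w a b by (simp add: mult_add_distrib_mat_vec[of _ n n] mult_mat_vec[of _ n n])
    then have eq: "a * v $ i + t * (b * w $ i) = d * (v $ i + t * w $ i)" if "i < n" for i
      using arg_cong[OF d, of "\<lambda>x. x $ i"] that v w by simp
    have eq': "(d - a) * v $ i = t * (b - d) * w $ i" if "i < n" for i
      using eq[OF that] by (simp add: algebra_simps)
    \<comment> \<open>If \<open>d = a\<close>, then \<open>b = d\<close>, because \<open>t\<close>
      and \<open>w\<close> are nonzero. Otherwise \<open>v\<close> is a nonzero multiple of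
      \<open>w\<close>, and \<open>w\<close> inherits the eigenvalue of \<open>v\<close>.\<close>
    show ?thesis
    proof (cases "d = a")
      case True
      have "w \<noteq> 0\<^sub>v n" using w f by auto
      then obtain i where "i < n" "w $ i \<noteq> 0" using w by (metis eq_vecI carrier_vecD index_zero_vec)
      then have "b = d" using eq'[of i] True t by auto
      then show ?thesis using True b by simp
    next
      case False
      then have vi: "v $ i = (t * (b - d) / (d - a)) * w $ i" if "i < n" for i
        using eq'[OF that] by (simp add: field_simps)
      then have vw: "v = (t * (b - d) / (d - a)) \<cdot>\<^sub>v w" (is "v = ?k \<cdot>\<^sub>v w") using v w by auto
      have k: "?k \<noteq> 0" using vw v(2) w f by auto
      have "?k \<cdot>\<^sub>v (A *\<^sub>v w) = ?k \<cdot>\<^sub>v (a \<cdot>\<^sub>v w)"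
        using a A w unfolding vw by (simp add: mult_mat_vec[of _ n n] smult_smult_assoc mult.commute)
      then have "?k * (A *\<^sub>v w) $ i = ?k * (a * w $ i)" if "i < n" for i
        using arg_cong[of _ _ "\<lambda>x. x $ i"] that w A by (metis index_smult_vec carrier_vecD carrier_matD(1) dim_mult_mat_vec index_smult_vec(2))
      then show ?thesis using k A w by (intro eq_vecI) auto
    qed
  qed
  have "A = a \<cdot>\<^sub>m 1\<^sub>m n"
  proof (rule ccontr)
    assume "A \<noteq> a \<cdot>\<^sub>m 1\<^sub>m n"
    then obtain i where i: "i < n" "row A i - a \<cdot>\<^sub>v unit_vec n i \<noteq> 0\<^sub>v n"
    proof -
      assume *: "\<And>i. i < n \<Longrightarrow> row A i - a \<cdot>\<^sub>v unit_vec n i \<noteq> 0\<^sub>v n \<Longrightarrow> thesis"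
      obtain i j where ij: "i < n" "j < n" "A $$ (i, j) \<noteq> (a \<cdot>\<^sub>m 1\<^sub>m n) $$ (i, j)"
        using \<open>A \<noteq> a \<cdot>\<^sub>m 1\<^sub>m n\<close> A by (metis (no_types, lifting) eq_matI carrier_matD one_carrier_mat smult_carrier_mat)
      then have "(row A i - a \<cdot>\<^sub>v unit_vec n i) $ j \<noteq> 0" using A by (auto split: if_splits)
      then have "row A i - a \<cdot>\<^sub>v unit_vec n i \<noteq> 0\<^sub>v n" using ij(2) by (metis index_zero_vec(1))
      with ij show thesis by (intro *[of i])
    qed
    let ?e = "row A i - a \<cdot>\<^sub>v unit_vec n i"
    obtain w where w: "w \<in> carrier_vec n" "f \<bullet> w \<noteq> 0" "g \<bullet> w \<noteq> 0" "?e \<bullet> w \<noteq> 0"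
      using common_nonvanishing[OF big, of "[f, g, ?e]" n] f g A i by auto
    have "?e \<bullet> w = (A *\<^sub>v w) $ i - a * w $ i"
      using w A i by (simp add: minus_scalar_prod_distrib[of _ n])
    also have "\<dots> = 0" using all[OF w(1-3)] i w by simp
    finally show False using w by simp
  qed
  then show False using A by blast
qed

section \<open>Rank at least two and the choice of the first basis vector\<close>

definition outer_prod :: "nat \<Rightarrow> 'a :: semiring_0 vec \<Rightarrow> 'a vec \<Rightarrow> 'a mat" where
  "outer_prod n p q = mat n n (\<lambda>(i, j). p $ i * q $ j)"

text \<open>The rank is at least two.\<close>

definition not_outer :: "nat \<Rightarrow> 'a :: field mat \<Rightarrow> bool" where
  "not_outer n A \<longleftrightarrow> (\<forall>p \<in> carrier_vec n. \<forall>q \<in> carrier_vec n. A \<noteq> outer_prod n p q)"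

text \<open>Fix \<open>k\<close> with \<open>c $ k\<close> nonzero. The vectors
  \<open>c_k e_i - c_i e_k\<close> annihilate \<open>c\<close>; if the transpose of \<open>A\<close>
  killed them all, every row of \<open>A\<close> would be \<open>c_i / c_k\<close> times row
  \<open>k\<close>, and \<open>A\<close> would have rank at most one. The resulting \<open>h\<close>
  serves to keep \<open>c\<close> off the line of \<open>A v\<close>.\<close>

lemma not_outer_annihilator:
  fixes A :: "'a :: field mat"
  assumes A: "A \<in> carrier_mat n n" "not_outer n A" and c: "c \<in> carrier_vec n" "c \<noteq> 0\<^sub>v n"
  shows "\<exists>h \<in> carrier_vec n. h \<bullet> c = 0 \<and> transpose_mat A *\<^sub>v h \<noteq> 0\<^sub>v n"
proof (rule ccontr)
  assume "\<not> ?thesis"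
  then have H: "transpose_mat A *\<^sub>v h = 0\<^sub>v n" if "h \<in> carrier_vec n" "h \<bullet> c = 0" for h using that by blast
  obtain k where k: "k < n" "c $ k \<noteq> 0" using c by (metis eq_vecI carrier_vecD index_zero_vec)
  have "A $$ (i, j) = c $ i * (A $$ (k, j) / c $ k)" if ij: "i < n" "j < n" for i j
  proof -
    define h where "h = c $ k \<cdot>\<^sub>v unit_vec n i - c $ i \<cdot>\<^sub>v unit_vec n k"
    have h: "h \<in> carrier_vec n" by (simp add: h_def)
    have "h \<bullet> c = 0" unfolding h_def using ij k c
      by (simp add: minus_scalar_prod_distrib[of _ n] mult.commute)
    then have "0 = (transpose_mat A *\<^sub>v h) $ j" using H[OF h] ij by simp
    also have "\<dots> = h \<bullet> col A j" using ij A h by (auto intro: comm_scalar_prod[of _ n])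
    also have "\<dots> = c $ k * A $$ (i, j) - c $ i * A $$ (k, j)"
      unfolding h_def using ij k A by (simp add: minus_scalar_prod_distrib[of _ n])
    finally show ?thesis using k by (simp add: field_simps)
  qed
  then have "A = outer_prod n c (vec n (\<lambda>j. A $$ (k, j) / c $ k))"
    using A by (intro eq_matI) (auto simp: outer_prod_def)
  then show False using A c unfolding not_outer_def by auto
qed

text \<open>The final disjunction ensures that, in a basis starting with \<open>v\<close>, \<open>A v\<close>, the rows of \<open>A\<close> beyond
  the first two do not all vanish.\<close>

lemma exists_cyclic_start:
  fixes A :: "'a :: field mat"
  assumes big: "\<And>T :: 'a set. finite T \<Longrightarrow> card T \<le> 3 \<Longrightarrow> T \<noteq> UNIV"
    and A: "A \<in> carrier_mat n n" "\<And>a. A \<noteq> a \<cdot>\<^sub>m 1\<^sub>m n" "not_outer n A"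
    and c: "c \<in> carrier_vec n" "c \<noteq> 0\<^sub>v n" and r: "r \<in> carrier_vec n" "r \<noteq> 0\<^sub>v n"
  shows "\<exists>v \<in> carrier_vec n. r \<bullet> v \<noteq> 0 \<and> (\<forall>a. A *\<^sub>v v \<noteq> a \<cdot>\<^sub>v v) \<and> (\<forall>a. c \<noteq> a \<cdot>\<^sub>v (A *\<^sub>v v)) \<and>
    ((\<forall>y \<in> carrier_vec n. transpose_mat A *\<^sub>v y = 0\<^sub>v n \<longrightarrow> y = 0\<^sub>v n) \<or>
     (\<exists>y \<in> carrier_vec n. transpose_mat A *\<^sub>v y = 0\<^sub>v n \<and> y \<bullet> v \<noteq> 0))"
proof -
  \<comment> \<open>The functional \<open>h\<close> kills \<open>c\<close>, so \<open>c\<close> is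
    not a multiple of \<open>A v\<close> as soon as \<open>h\<close> is nonzero at
    \<open>A v\<close>, that is, \<open>?g\<close> is nonzero at \<open>v\<close>.\<close>
  obtain h where h: "h \<in> carrier_vec n" "h \<bullet> c = 0" "transpose_mat A *\<^sub>v h \<noteq> 0\<^sub>v n"
    using not_outer_annihilator[OF A(1,3) c] by blast
  let ?g = "transpose_mat A *\<^sub>v h"
  have g: "?g \<in> carrier_vec n" using A h by auto
  have nc: "c \<noteq> a \<cdot>\<^sub>v (A *\<^sub>v v)" if v: "v \<in> carrier_vec n" "?g \<bullet> v \<noteq> 0" for v a
  proof
    assume "c = a \<cdot>\<^sub>v (A *\<^sub>v v)"
    then have "0 = a * (h \<bullet> (A *\<^sub>v v))" using h v A by simp
    also have "h \<bullet> (A *\<^sub>v v) = ?g \<bullet> v" using scalar_prod_transpose_mult_vec[OF A(1) h(1) v(1)] by simp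
    finally have "a = 0" using v by simp
    then have "c = 0\<^sub>v n" using \<open>c = _\<close> A v by auto
    then show False using c by simp
  qed
  show ?thesis
  proof (cases "\<forall>y \<in> carrier_vec n. transpose_mat A *\<^sub>v y = 0\<^sub>v n \<longrightarrow> y = 0\<^sub>v n")
    case True
    then show ?thesis using nonscalar_noneigenvector[OF big A(1,2) r g h(3)] nc by blast
  next
    \<comment> \<open>In the singular case \<open>v\<close> is taken off the hyperplanes of
      \<open>r\<close>, of a left kernel vector \<open>y\<close> and of \<open>?g\<close>. Such a
      \<open>v\<close> is no eigenvector: \<open>y\<close> forces the eigenvalue 0, while
      \<open>h\<close> shows that \<open>A v\<close> is nonzero.\<close>
    case False
    then obtain y where y: "y \<in> carrier_vec n" "transpose_mat A *\<^sub>v y = 0\<^sub>v n" "y \<noteq> 0\<^sub>v n" by blast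
    obtain v where v: "v \<in> carrier_vec n" "r \<bullet> v \<noteq> 0" "y \<bullet> v \<noteq> 0" "?g \<bullet> v \<noteq> 0"
      using common_nonvanishing[OF big, of "[r, y, ?g]" n] r y g h by auto
    have "A *\<^sub>v v \<noteq> a \<cdot>\<^sub>v v" for a
    proof
      assume e: "A *\<^sub>v v = a \<cdot>\<^sub>v v"
      have "y \<bullet> (A *\<^sub>v v) = 0" using scalar_prod_transpose_mult_vec[OF A(1) y(1) v(1)] y(2) v by simp
      then have "a = 0" using e v y by simp
      then have "h \<bullet> (A *\<^sub>v v) = 0" using e v h by simp
      then show False using scalar_prod_transpose_mult_vec[OF A(1) h(1) v(1)] v by simp
    qed
    then show ?thesis using v y nc by blast
  qed
qed

section \<open>Rank-one updates and bases with two prescribed vectors\<close>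

definition rank_one_update :: "nat \<Rightarrow> 'a :: field vec \<Rightarrow> 'a vec \<Rightarrow> 'a mat" where
  "rank_one_update n w f = 1\<^sub>m n + outer_prod n w f"

lemma outer_prod_carrier [simp]: "outer_prod n p q \<in> carrier_mat n n"
  by (simp add: outer_prod_def)

lemma rank_one_update_carrier [simp]: "rank_one_update n w f \<in> carrier_mat n n"
  by (simp add: rank_one_update_def)

lemma outer_prod_mult_vec:
  fixes p :: "'a :: field vec"
  assumes "p \<in> carrier_vec n" "q \<in> carrier_vec n" "x \<in> carrier_vec n"
  shows "outer_prod n p q *\<^sub>v x = (q \<bullet> x) \<cdot>\<^sub>v p"
  using assms by (intro eq_vecI) (auto simp: outer_prod_def scalar_prod_def sum_distrib_right sum_distrib_left mult_ac)

lemma mult_outer_prod: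
  fixes p :: "'a :: field vec"
  assumes "p \<in> carrier_vec n" "q \<in> carrier_vec n" "M \<in> carrier_mat n n"
  shows "M * outer_prod n p q = outer_prod n (M *\<^sub>v p) q"
  using assms by (intro eq_matI) (auto simp: outer_prod_def scalar_prod_def sum_distrib_right sum_distrib_left mult_ac)

lemma outer_prod_mult:
  fixes p :: "'a :: field vec"
  assumes "p \<in> carrier_vec n" "q \<in> carrier_vec n" "M \<in> carrier_mat n n"
  shows "outer_prod n p q * M = outer_prod n p (transpose_mat M *\<^sub>v q)"
  using assms by (intro eq_matI) (auto simp: outer_prod_def scalar_prod_def sum_distrib_left mult_ac)

lemma rank_one_update_mult_vec:
  assumes "w \<in> carrier_vec n" "f \<in> carrier_vec n" "x \<in> carrier_vec n"
  shows "rank_one_update n w f *\<^sub>v x = x + (f \<bullet> x) \<cdot>\<^sub>v w"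
  using assms unfolding rank_one_update_def
  by (subst add_mult_distrib_mat_vec[of _ n n]) (auto simp: outer_prod_mult_vec)

lemma transpose_rank_one_update:
  "w \<in> carrier_vec n \<Longrightarrow> f \<in> carrier_vec n \<Longrightarrow> transpose_mat (rank_one_update n w f) = rank_one_update n f w"
  by (intro eq_matI) (auto simp: rank_one_update_def outer_prod_def)

lemma mat_eq_one_if_fixes_all:
  fixes M :: "'a :: field mat"
  assumes M: "M \<in> carrier_mat n n" and fixed: "\<And>x. x \<in> carrier_vec n \<Longrightarrow> M *\<^sub>v x = x"
  shows "M = 1\<^sub>m n"
proof (rule eq_matI)
  fix i j assume ij: "i < dim_row (1\<^sub>m n :: 'a mat)" "j < dim_col (1\<^sub>m n :: 'a mat)"
  have "M $$ (i, j) = (M *\<^sub>v unit_vec n j) $ i" using M ij by simp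
  then show "M $$ (i, j) = 1\<^sub>m n $$ (i, j)" using fixed[of "unit_vec n j"] ij by simp
qed (use M in auto)

text \<open>The Sherman-Morrison formula: the inverse is the update by
  \<open>- w / (1 + f w)\<close> along the same functional.\<close>

lemma rank_one_update_inverse:
  fixes w f :: "'a :: field vec"
  assumes w: "w \<in> carrier_vec n" and f: "f \<in> carrier_vec n" and nz: "1 + f \<bullet> w \<noteq> 0"
  obtains Q where "Q \<in> carrier_mat n n" "rank_one_update n w f * Q = 1\<^sub>m n" "Q * rank_one_update n w f = 1\<^sub>m n"
proof -
  define a where "a = 1 / (1 + f \<bullet> w)"
  define Q where "Q = rank_one_update n (- a \<cdot>\<^sub>v w) f"
  have Q: "Q \<in> carrier_mat n n" by (simp add: Q_def)
  have "rank_one_update n w f * Q = 1\<^sub>m n"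
  proof (rule mat_eq_one_if_fixes_all)
    fix x :: "'a vec" assume x: "x \<in> carrier_vec n"
    have Qx: "Q *\<^sub>v x = x + (f \<bullet> x) \<cdot>\<^sub>v (- a \<cdot>\<^sub>v w)" unfolding Q_def using w f x by (simp add: rank_one_update_mult_vec)
    have "(rank_one_update n w f * Q) *\<^sub>v x = Q *\<^sub>v x + (f \<bullet> (Q *\<^sub>v x)) \<cdot>\<^sub>v w"
      using Q w f x by (simp add: assoc_mult_mat_vec[of _ n n _ n] rank_one_update_mult_vec)
    also have "f \<bullet> (Q *\<^sub>v x) = (f \<bullet> x) * a"
    proof -
      have "f \<bullet> (Q *\<^sub>v x) = f \<bullet> x - (f \<bullet> x) * (a * (f \<bullet> w))"
        unfolding Qx using w f x by (simp add: scalar_prod_add_distrib[of _ n])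
      also have "\<dots> = (f \<bullet> x) * (a * (1 + f \<bullet> w)) - (f \<bullet> x) * (a * (f \<bullet> w))" using nz by (simp add: a_def)
      also have "\<dots> = (f \<bullet> x) * a" by (simp only: distrib_left mult_1_right add_diff_cancel_right')
      finally show ?thesis .
    qed
    finally have e: "(rank_one_update n w f * Q) *\<^sub>v x = Q *\<^sub>v x + ((f \<bullet> x) * a) \<cdot>\<^sub>v w" .
    show "(rank_one_update n w f * Q) *\<^sub>v x = x" unfolding e Qx
    proof (rule eq_vecI)
      fix i assume "i < dim_vec x"
      then show "(x + (f \<bullet> x) \<cdot>\<^sub>v (- a \<cdot>\<^sub>v w) + ((f \<bullet> x) * a) \<cdot>\<^sub>v w) $ i = x $ i"
        using w x by simp
    qed (use w x in simp)
  qed (simp add: Q mult_carrier_mat[of _ n n])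
  moreover from this have "Q * rank_one_update n w f = 1\<^sub>m n"
    using mat_mult_left_right_inverse[OF rank_one_update_carrier Q] by blast
  ultimately show thesis using that Q by blast
qed

text \<open>Two rank-one updates suffice: \<open>P1\<close> sends \<open>e_0\<close> to
  \<open>v\<close>, and \<open>P2\<close> fixes \<open>e_0\<close> and sends \<open>e_1\<close> to
  the preimage of \<open>u\<close> under \<open>P1\<close>.\<close>

lemma exists_basis_two_columns:
  fixes u v :: "'a :: field vec"
  assumes n: "n \<ge> 2" and v: "v \<in> carrier_vec n" "v \<noteq> 0\<^sub>v n" and u: "u \<in> carrier_vec n" "\<And>a. u \<noteq> a \<cdot>\<^sub>v v"
  obtains P Q where "P \<in> carrier_mat n n" "Q \<in> carrier_mat n n" "P * Q = 1\<^sub>m n" "Q * P = 1\<^sub>m n"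
    "P *\<^sub>v unit_vec n 0 = v" "P *\<^sub>v unit_vec n 1 = u"
proof -
  let ?e = "\<lambda>i. unit_vec n i :: 'a vec"
  obtain k where k: "k < n" "v $ k \<noteq> 0" using v by (metis eq_vecI carrier_vecD index_zero_vec)
  \<comment> \<open>With \<open>f\<close> equal to 1 at \<open>e_0\<close>, the update by
    \<open>v - e_0\<close> sends \<open>e_0\<close> to \<open>v\<close>; it is invertible because
    \<open>1 + f (v - e_0) = f v\<close> is nonzero.\<close>
  define f where "f = (if v $ 0 \<noteq> 0 then ?e 0 else ?e 0 + ?e k)"
  have f: "f \<in> carrier_vec n" "f \<bullet> ?e 0 = 1" "f \<bullet> v \<noteq> 0"
    using n k v(1) by (auto simp: f_def add_scalar_prod_distrib[of _ n])
  define P1 where "P1 = rank_one_update n (v - ?e 0) f"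
  have "1 + f \<bullet> (v - ?e 0) \<noteq> 0" using f v by (simp add: scalar_prod_minus_distrib[of _ n])
  then obtain Q1 where Q1: "Q1 \<in> carrier_mat n n" "P1 * Q1 = 1\<^sub>m n" "Q1 * P1 = 1\<^sub>m n"
    using rank_one_update_inverse[of "v - ?e 0" n f] f v unfolding P1_def by (metis minus_carrier_vec unit_vec_carrier)
  have P1: "P1 \<in> carrier_mat n n" by (simp add: P1_def)
  have P1e: "P1 *\<^sub>v ?e 0 = v" unfolding P1_def using f v
    by (subst rank_one_update_mult_vec) (auto intro!: eq_vecI)
  define u1 where "u1 = Q1 *\<^sub>v u"
  have u1: "u1 \<in> carrier_vec n" using Q1 u by (auto simp: u1_def)
  have P1u: "P1 *\<^sub>v u1 = u" unfolding u1_def using P1 Q1 u by (metis assoc_mult_mat_vec one_mult_mat_vec)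
  have "\<exists>i<n. i \<noteq> 0 \<and> u1 $ i \<noteq> 0"
  proof (rule ccontr)
    assume "\<not> ?thesis"
    then have "u1 = u1 $ 0 \<cdot>\<^sub>v ?e 0" using u1 n by (intro eq_vecI) auto
    then have "u = u1 $ 0 \<cdot>\<^sub>v v" using P1u P1e P1 by (metis mult_mat_vec unit_vec_carrier)
    then show False using u by blast
  qed
  then obtain l where l: "l < n" "l \<noteq> 0" "u1 $ l \<noteq> 0" by blast
  \<comment> \<open>The same choice one index further. Since \<open>u\<close> is not a multiple of
    \<open>v\<close>, some coordinate of \<open>u1\<close> beyond the first is nonzero, so
    \<open>g\<close> can also be made to kill \<open>e_0\<close>; this is why \<open>P2\<close>
    fixes \<open>e_0\<close>.\<close>
  define g where "g = (if u1 $ 1 \<noteq> 0 then ?e 1 else ?e 1 + ?e l)"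
  have g: "g \<in> carrier_vec n" "g \<bullet> ?e 0 = 0" "g \<bullet> ?e 1 = 1" "g \<bullet> u1 \<noteq> 0"
    using n l u1 by (auto simp: g_def add_scalar_prod_distrib[of _ n])
  define P2 where "P2 = rank_one_update n (u1 - ?e 1) g"
  have "1 + g \<bullet> (u1 - ?e 1) \<noteq> 0" using g u1 by (simp add: scalar_prod_minus_distrib[of _ n])
  then obtain Q2 where Q2: "Q2 \<in> carrier_mat n n" "P2 * Q2 = 1\<^sub>m n" "Q2 * P2 = 1\<^sub>m n"
    using rank_one_update_inverse[of "u1 - ?e 1" n g] g u1 unfolding P2_def by (metis minus_carrier_vec unit_vec_carrier)
  have P2: "P2 \<in> carrier_mat n n" by (simp add: P2_def)
  have P2e0: "P2 *\<^sub>v ?e 0 = ?e 0" unfolding P2_def using g u1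
    by (subst rank_one_update_mult_vec) (auto intro!: eq_vecI)
  have P2e1: "P2 *\<^sub>v ?e 1 = u1" unfolding P2_def using g u1
    by (subst rank_one_update_mult_vec) (auto intro!: eq_vecI)
  show thesis
  proof (rule that[of "P1 * P2" "Q2 * Q1"])
    have e: "(P1 * P2) * (Q2 * Q1) = P1 * (P2 * Q2) * Q1"
      using P1 P2 Q1(1) Q2(1) by (simp add: assoc_mult_mat[of _ n n _ n _ n])
    show "(P1 * P2) * (Q2 * Q1) = 1\<^sub>m n" unfolding e Q2(2) using P1 Q1 by simp
    have e: "(Q2 * Q1) * (P1 * P2) = Q2 * (Q1 * P1) * P2"
      using P1 P2 Q1(1) Q2(1) by (simp add: assoc_mult_mat[of _ n n _ n _ n])
    show "(Q2 * Q1) * (P1 * P2) = 1\<^sub>m n" unfolding e Q1(3) using P2 Q2 by simp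
    show "P1 * P2 *\<^sub>v ?e 0 = v" "P1 * P2 *\<^sub>v ?e 1 = u"
      using P1 P2 P1e P1u P2e0 P2e1 by (simp_all add: assoc_mult_mat_vec[of _ n n _ n])
  qed (use P1 P2 Q1 Q2 in auto)
qed

section \<open>The block that remains behind a column \<open>e_1\<close>\<close>

lemma not_outer_minorI:
  fixes B :: "'a :: field mat"
  assumes "i < n" "k < n" "j < n" "l < n" "B $$ (i, j) * B $$ (k, l) \<noteq> B $$ (i, l) * B $$ (k, j)"
  shows "not_outer n B"
  using assms unfolding not_outer_def outer_prod_def by auto

lemma not_outer_similar:
  fixes A :: "'a :: field mat"
  assumes "not_outer n A" "A = P * A' * Q" "P \<in> carrier_mat n n" "Q \<in> carrier_mat n n"
  shows "not_outer n A'"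
  unfolding not_outer_def
proof (intro ballI notI)
  fix p q assume pq: "p \<in> carrier_vec n" "q \<in> carrier_vec n" "A' = outer_prod n p q"
  then have "A = outer_prod n (P *\<^sub>v p) (transpose_mat Q *\<^sub>v q)"
    using assms by (simp add: mult_outer_prod outer_prod_mult)
  moreover have "P *\<^sub>v p \<in> carrier_vec n" "transpose_mat Q *\<^sub>v q \<in> carrier_vec n" using pq assms by auto
  ultimately show False using assms(1) unfolding not_outer_def by blast
qed

text \<open>The trailing block of \<open>A\<close> after conjugation by \<open>1 + e\<^sub>0 t\<^sup>T\<close>, where \<open>A e\<^sub>0 = e\<^sub>1\<close> and
  the entries \<open>0\<close> and \<open>1\<close> of \<open>t\<close> count as \<open>0\<close>.\<close>

definition shifted_block :: "'a :: field mat \<Rightarrow> 'a vec \<Rightarrow> 'a mat" where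
  "shifted_block A t = mat (dim_row A - 1) (dim_row A - 1)
     (\<lambda>(i, j). A $$ (Suc i, Suc j) - (if i = 0 \<and> j \<noteq> 0 then t $ Suc j else 0))"

text \<open>The shift affects only row 0 of the block, while row \<open>i - 1\<close> keeps its
  nonzero entry. A 2x2 minor on these two rows is therefore affine in \<open>t\<close>, and the
  normalization \<open>t $ 0 = 1\<close> turns affine conditions into linear functionals. The cases
  differ in which minor is used and in what excludes a scalar block.\<close>

lemma shifted_block_functional:
  fixes A :: "'a :: field mat"
  assumes A: "A \<in> carrier_mat (Suc m) (Suc m)" and m: "m \<ge> 2"
    and col0: "\<And>i. i < Suc m \<Longrightarrow> A $$ (i, 0) = (if i = 1 then 1 else 0)"
    and tr: "mat_trace A = 0" and ij: "2 \<le> i" "i < Suc m" "j < Suc m" "A $$ (i, j) \<noteq> 0"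
  obtains g where "g \<in> carrier_vec (Suc m)" "g \<noteq> 0\<^sub>v (Suc m)"
    "\<And>t. t \<in> carrier_vec (Suc m) \<Longrightarrow> t $ 0 = 1 \<Longrightarrow> g \<bullet> t \<noteq> 0 \<Longrightarrow>
      not_outer m (shifted_block A t) \<and> (\<forall>a. shifted_block A t \<noteq> a \<cdot>\<^sub>m 1\<^sub>m m)"
proof -
  let ?n = "Suc m" let ?e = "unit_vec (Suc m) :: nat \<Rightarrow> 'a vec"
  have B: "shifted_block A t $$ (k, l) = A $$ (Suc k, Suc l) - (if k = 0 \<and> l \<noteq> 0 then t $ Suc l else 0)"
    if "k < m" "l < m" for t k l using that A by (simp add: shifted_block_def)
  obtain i' where i': "i = Suc i'" "i' > 0" "i' < m" using ij by (cases i) auto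
  have j0: "j \<noteq> 0" using ij col0[of i] by (cases "j = 0") auto
  then obtain j' where j': "j = Suc j'" "j' < m" using ij by (cases j) auto
  have scalar_entry: "B = a \<cdot>\<^sub>m 1\<^sub>m m \<Longrightarrow> k < m \<Longrightarrow> l < m \<Longrightarrow> B $$ (k, l) = (if k = l then a else 0)" for B :: "'a mat" and a k l
    by auto
  consider (a) "A $$ (i, 1) \<noteq> 0" | (b) "A $$ (i, 1) = 0" "A $$ (1, 1) \<noteq> 0" | (c) "A $$ (i, 1) = 0" "A $$ (1, 1) = 0" by blast
  then show thesis
  proof cases
    \<comment> \<open>The minor on columns 0 and 1 of the block is \<open>x + A_i1 t_2\<close>; the
      entry below the diagonal in column 0 excludes a scalar block.\<close>
    case a
    define x where "x = A $$ (1, 1) * A $$ (i, 2) - A $$ (1, 2) * A $$ (i, 1)"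
    define g where "g = x \<cdot>\<^sub>v ?e 0 + A $$ (i, 1) \<cdot>\<^sub>v ?e 2"
    have g2: "g $ 2 \<noteq> 0" using a m by (simp add: g_def)
    show thesis
    proof (rule that[of g])
      show "g \<noteq> 0\<^sub>v ?n" using g2 m by auto
      fix t :: "'a vec" assume t: "t \<in> carrier_vec ?n" "t $ 0 = 1" "g \<bullet> t \<noteq> 0"
      have "g \<bullet> t = x + A $$ (i, 1) * t $ 2" unfolding g_def using t m
        by (simp add: add_scalar_prod_distrib[of _ ?n])
      then have "not_outer m (shifted_block A t)"
        using t m i' by (intro not_outer_minorI[of 0 _ i' 0 1]) (auto simp: B x_def numeral_2_eq_2 algebra_simps)
      moreover have "shifted_block A t $$ (i', 0) \<noteq> 0" using a i' m by (simp add: B)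
      ultimately show "not_outer m (shifted_block A t) \<and> (\<forall>a. shifted_block A t \<noteq> a \<cdot>\<^sub>m 1\<^sub>m m)"
        using scalar_entry[of "shifted_block A t" _ i' 0] i' m by auto
    qed (simp add: g_def)
  next
    \<comment> \<open>Here the minor on columns 0 and \<open>j'\<close> is \<open>A_11 A_ij\<close>,
      nonzero for every \<open>t\<close>. The functional is spent on making the entry (0, 1) of the
      block nonzero, which excludes a scalar block.\<close>
    case b
    define g where "g = A $$ (1, 2) \<cdot>\<^sub>v ?e 0 - ?e 2"
    have g2: "g $ 2 \<noteq> 0" using m by (simp add: g_def)
    have j1: "j' \<noteq> 0" using b ij j' by (cases "j' = 0") auto
    show thesis
    proof (rule that[of g])
      show "g \<noteq> 0\<^sub>v ?n" using g2 m by auto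
      fix t :: "'a vec" assume t: "t \<in> carrier_vec ?n" "t $ 0 = 1" "g \<bullet> t \<noteq> 0"
      have "g \<bullet> t = A $$ (1, 2) - t $ 2" unfolding g_def using t m
        by (simp add: minus_scalar_prod_distrib[of _ ?n])
      then have "shifted_block A t $$ (0, 1) \<noteq> 0" using t m by (simp add: B numeral_2_eq_2)
      moreover have "not_outer m (shifted_block A t)"
        using t m i' j' j1 b ij by (intro not_outer_minorI[of 0 _ i' 0 j']) (auto simp: B)
      ultimately show "not_outer m (shifted_block A t) \<and> (\<forall>a. shifted_block A t \<noteq> a \<cdot>\<^sub>m 1\<^sub>m m)"
        using scalar_entry[of "shifted_block A t" _ 0 1] m by auto
    qed (simp add: g_def)
  next
    \<comment> \<open>Column 0 of the block vanishes in both rows, so the minor needs two other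
      columns \<open>j'\<close> and \<open>k'\<close>. Its coefficient at \<open>t_k\<close> is
      \<open>A_ij\<close>.\<close>
    case c
    have j1: "j' \<noteq> 0" using c ij j' by (cases "j' = 0") auto
    \<comment> \<open>For \<open>m = 2\<close> there is no second column, but then
      \<open>A_22\<close> would be the only nonzero diagonal entry, against trace zero.\<close>
    have "m \<noteq> 2"
    proof
      assume m2: "m = 2"
      then have "i = 2" "j = 2" using ij i' j' j1 by auto
      moreover have "mat_trace A = A $$ (0, 0) + A $$ (1, 1) + A $$ (2, 2)"
        using A m2 by (simp add: mat_trace_def numeral_3_eq_3 numeral_2_eq_2)
      ultimately show False using tr c col0[of 0] ij by simp
    qed
    then obtain k' where k': "k' < m" "k' \<noteq> 0" "k' \<noteq> j'" 
      using m that[of "if j' = 1 then 2 else 1"] by (auto split: if_splits)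
    define k where "k = Suc k'"
    define x where "x = A $$ (1, j) * A $$ (i, k) - A $$ (1, k) * A $$ (i, j)"
    define g where "g = x \<cdot>\<^sub>v ?e 0 + (A $$ (i, j) \<cdot>\<^sub>v ?e k - A $$ (i, k) \<cdot>\<^sub>v ?e j)"
    have k: "k < ?n" "k \<noteq> 0" "k \<noteq> j" using k' j' by (auto simp: k_def)
    have gk: "g $ k \<noteq> 0" using k ij by (simp add: g_def)
    show thesis
    proof (rule that[of g])
      show "g \<noteq> 0\<^sub>v ?n" using gk k by auto
      fix t :: "'a vec" assume t: "t \<in> carrier_vec ?n" "t $ 0 = 1" "g \<bullet> t \<noteq> 0"
      have "g \<bullet> t = x + A $$ (i, j) * t $ k - A $$ (i, k) * t $ j" unfolding g_def using t k ij
        by (simp add: add_scalar_prod_distrib[of _ ?n] minus_scalar_prod_distrib[of _ ?n])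
      then have "not_outer m (shifted_block A t)"
        using t k' i' j' j1 by (intro not_outer_minorI[of 0 _ i' j' k']) (auto simp: B x_def k_def algebra_simps)
      moreover have "shifted_block A t \<noteq> a \<cdot>\<^sub>m 1\<^sub>m m" for a
      proof
        assume s: "shifted_block A t = a \<cdot>\<^sub>m 1\<^sub>m m"
        have "a = 0" using scalar_entry[OF s, of 0 0] B[of 0 0 t] m c by simp
        then have "shifted_block A t = outer_prod m (0\<^sub>v m) (0\<^sub>v m)" using s by (intro eq_matI) (auto simp: outer_prod_def)
        then show False using \<open>not_outer m _\<close> unfolding not_outer_def by auto
      qed
      ultimately show "not_outer m (shifted_block A t) \<and> (\<forall>a. shifted_block A t \<noteq> a \<cdot>\<^sub>m 1\<^sub>m m)" by blast
    qed (simp add: g_def)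
  qed
qed

text \<open>Conjugation by \<open>1 + e_0 t^T\<close> with \<open>t\<close> zero at 0 and 1 keeps
  the first column \<open>e_1\<close>. The shift \<open>t\<close> is chosen so that the new column
  has nonzero first entry, the row to the right of the corner is nonzero, and the trailing block
  again satisfies the induction hypothesis; then the first row and column are peeled off.\<close>

lemma rooted_of_cyclic_column:
  fixes A :: "'a :: field mat"
  assumes big: "\<And>T :: 'a set. finite T \<Longrightarrow> card T \<le> 3 \<Longrightarrow> T \<noteq> UNIV"
    and A: "A \<in> carrier_mat (Suc m) (Suc m)" and m: "m \<ge> 2"
    and col0: "\<And>i. i < Suc m \<Longrightarrow> A $$ (i, 0) = (if i = 1 then 1 else 0)"
    and tr: "mat_trace A = 0" and ij: "2 \<le> i" "i < Suc m" "j < Suc m" "A $$ (i, j) \<noteq> 0"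
    and c: "c \<in> carrier_vec (Suc m)" and ck: "k < Suc m" "k \<noteq> 1" "c $ k \<noteq> 0"
    and r: "r \<in> carrier_vec (Suc m)" "r $ 0 \<noteq> 0"
    and IH: "\<And>(B :: 'a mat) c r. B \<in> carrier_mat m m \<Longrightarrow> mat_trace B = 0 \<Longrightarrow> (\<And>a. B \<noteq> a \<cdot>\<^sub>m 1\<^sub>m m) \<Longrightarrow> not_outer m B \<Longrightarrow>
      c \<in> carrier_vec m \<Longrightarrow> c \<noteq> 0\<^sub>v m \<Longrightarrow> r \<in> carrier_vec m \<Longrightarrow> r \<noteq> 0\<^sub>v m \<Longrightarrow> rooted m B c r"
  shows "rooted (Suc m) A c r"
proof -
  let ?n = "Suc m" let ?e = "unit_vec (Suc m) :: nat \<Rightarrow> 'a vec"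
  obtain g where g: "g \<in> carrier_vec ?n" "g \<noteq> 0\<^sub>v ?n"
    "\<And>t. t \<in> carrier_vec ?n \<Longrightarrow> t $ 0 = 1 \<Longrightarrow> g \<bullet> t \<noteq> 0 \<Longrightarrow>
      not_outer m (shifted_block A t) \<and> (\<forall>a. shifted_block A t \<noteq> a \<cdot>\<^sub>m 1\<^sub>m m)"
    using shifted_block_functional[OF A m col0 tr ij] by blast
  \<comment> \<open>On \<open>s\<close> with \<open>s\<^sub>0 = 1\<close>, \<open>F y\<close> is the affine function \<open>y\<^sub>0 + t\<^sup>T y\<close> of the shift \<open>t\<close>.\<close>
  define F where "F x = vec ?n (\<lambda>i. if i = 1 then 0 else x $ i)" for x :: "'a vec"
  have F: "F x \<in> carrier_vec ?n" for x by (simp add: F_def)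
  have F0: "F x \<noteq> 0\<^sub>v ?n" if "k < ?n" "k \<noteq> 1" "x $ k \<noteq> 0" for x k
  proof -
    have "F x $ k \<noteq> 0" using that by (simp add: F_def)
    then show ?thesis using that by auto
  qed
  \<comment> \<open>In this order: the homogenizing coordinate, the first entry of the transformed
    \<open>c\<close>, the entry (0, \<open>j\<close>) of the transformed matrix, and the condition
    on the trailing block. The entries \<open>k\<close> of \<open>c\<close> and \<open>i\<close> of
    column \<open>j\<close> show that dropping coordinate 1 leaves nonzero functionals.\<close>
  obtain x where x: "x \<in> carrier_vec ?n" "?e 0 \<bullet> x \<noteq> 0" "F c \<bullet> x \<noteq> 0" "F (col A j) \<bullet> x \<noteq> 0" "g \<bullet> x \<noteq> 0"
    using common_nonvanishing[OF big, of "[?e 0, F c, F (col A j), g]" ?n] g F F0[OF ck] F0[of i "col A j"] ij A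
      unit_vec_nonzero[of 0 ?n, where 'a = 'a, THEN not_sym] by auto
  define s where "s = (1 / x $ 0) \<cdot>\<^sub>v x"
  have x0: "x $ 0 \<noteq> 0" using x(1,2) by simp
  have s: "s \<in> carrier_vec ?n" "s $ 0 = 1" "F c \<bullet> s \<noteq> 0" "F (col A j) \<bullet> s \<noteq> 0" "g \<bullet> s \<noteq> 0"
    using x x0 F g by (auto simp: s_def)
  define t where "t = vec ?n (\<lambda>i. if i < 2 then 0 else s $ i)"
  have t: "t \<in> carrier_vec ?n" "t $ 0 = 0" "t $ 1 = 0" using m by (auto simp: t_def)
  have Ft: "F y \<bullet> s = y $ 0 + t \<bullet> y" if "y \<in> carrier_vec ?n" for y
  proof -
    obtain m' where "m = Suc m'" using m by (cases m) auto
    then show ?thesis using that s(1,2)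
      by (auto simp: F_def t_def scalar_prod_def atLeast0LessThan sum.lessThan_Suc_shift mult.commute simp del: sum.lessThan_Suc sum.op_ivl_Suc)
  qed
  \<comment> \<open>This is \<open>T A T^{-1}\<close> written out: since
    \<open>t_0 = t_1 = 0\<close> and \<open>A e_0 = e_1\<close>, it equals
    \<open>A + e_0 (t^T A) - e_1 t^T\<close>.\<close>
  define A' where "A' = mat ?n ?n (\<lambda>(i, j). A $$ (i, j) + (if i = 0 then t \<bullet> col A j else 0) - (if i = 1 then t $ j else 0))"
  have A': "A' \<in> carrier_mat ?n ?n" by (simp add: A'_def)
  have tc0: "t \<bullet> col A 0 = 0"
  proof -
    have "col A 0 = ?e 1" using A col0 m by (intro eq_vecI) auto
    then show ?thesis using t m by simp
  qed
  have A'0: "A' $$ (i, 0) = (if i = 1 then 1 else 0)" if "i < ?n" for i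
    using that col0 tc0 t by (auto simp: A'_def)
  have A'e: "A' *\<^sub>v ?e 0 = ?e 1" using A' A'0 m by (intro eq_vecI) auto
  define T where "T = rank_one_update ?n (?e 0) t"
  have T: "T \<in> carrier_mat ?n ?n" by (simp add: T_def)
  have "1 + t \<bullet> ?e 0 \<noteq> 0" using t by simp
  then obtain S where S: "S \<in> carrier_mat ?n ?n" "T * S = 1\<^sub>m ?n" "S * T = 1\<^sub>m ?n"
    using rank_one_update_inverse[of "?e 0" ?n t] t unfolding T_def by auto
  have TA: "T * A = A + outer_prod ?n (?e 0) (transpose_mat A *\<^sub>v t)"
    unfolding T_def rank_one_update_def using A t by (simp add: add_mult_distrib_mat[of _ ?n ?n] outer_prod_mult)
  have AT: "A' * T = A' + outer_prod ?n (?e 1) t"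
    unfolding T_def rank_one_update_def using A' A'e t
    by (simp add: mult_add_distrib_mat[of _ ?n ?n _ ?n] mult_outer_prod)
  have eq: "T * A = A' * T" unfolding TA AT
    using A A' t m by (intro eq_matI) (auto simp: outer_prod_def A'_def comm_scalar_prod[of _ ?n])
  \<comment> \<open>The inverse of \<open>T\<close> is \<open>1 - e_0 t^T\<close>, and its transpose
    sends \<open>r\<close> to this vector; \<open>t_0 = 0\<close> preserves the first entry.\<close>
  define r' where "r' = r - r $ 0 \<cdot>\<^sub>v t"
  have r': "r' \<in> carrier_vec ?n" "r' $ 0 = r $ 0" using r t by (auto simp: r'_def)
  have rT: "r = transpose_mat T *\<^sub>v r'"
    unfolding T_def using t r r' by (auto simp: transpose_rank_one_update rank_one_update_mult_vec r'_def)
  have Tc: "T *\<^sub>v c = c + (t \<bullet> c) \<cdot>\<^sub>v ?e 0" unfolding T_def using t c by (simp add: rank_one_update_mult_vec)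
  have tra: "trailing A' = shifted_block A s"
    using A A' m by (intro eq_matI) (auto simp: trailing_def shifted_block_def A'_def t_def)
  have "mat_trace A' = mat_trace A"
    unfolding mat_trace_def using A A' tc0 t col0[of 0] by (intro sum.cong) (auto simp: A'_def)
  then have trt: "mat_trace (trailing A') = 0"
    using tr A' A'0[of 0] by (simp add: mat_trace_def trailing_def sum.lessThan_Suc_shift del: sum.lessThan_Suc)
  have "rooted m (trailing A') (trailing_col A') (trailing_row A')"
  proof (rule IH)
    show "not_outer m (trailing A')" "\<And>a. trailing A' \<noteq> a \<cdot>\<^sub>m 1\<^sub>m m" unfolding tra using g(3)[OF s(1,2,5)] by auto
    have "trailing_col A' $ 0 \<noteq> 0" using A' A'0[of 1] m by (simp add: trailing_col_def)
    then show "trailing_col A' \<noteq> 0\<^sub>v m" using m by auto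
    have j0: "j \<noteq> 0" using ij col0[of i] by (cases "j = 0") auto
    have "F (col A j) \<bullet> s = A' $$ (0, j)" using Ft[of "col A j"] A ij by (simp add: A'_def)
    then have nz: "A' $$ (0, j) \<noteq> 0" using s(4) by simp
    obtain j' where j': "j = Suc j'" using j0 by (cases j) auto
    have "trailing_row A' $ j' \<noteq> 0" using nz A' ij unfolding j' by (simp add: trailing_row_def)
    then show "trailing_row A' \<noteq> 0\<^sub>v m" using ij j' by auto
  qed (use A' trt in auto)
  then have "rooted ?n A' (T *\<^sub>v c) r'"
  proof (rule rooted_peel[rotated -1])
    show "A' $$ (0, 0) = 0" using A'0[of 0] by simp
    show "(T *\<^sub>v c) $ 0 \<noteq> 0" unfolding Tc using c s(3) Ft[OF c] by simp
    show "r' $ 0 \<noteq> 0" using r r' by simp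
  qed (use A' T c r' in auto)
  then show ?thesis using rooted_conj[OF A A' S(1) T S(3,2) eq c r'(1) rT] by simp
qed

section \<open>The induction on the size\<close>

lemma mat_trace_similar:
  fixes A :: "'a :: field mat"
  assumes "A \<in> carrier_mat n n" "P \<in> carrier_mat n n" "Q \<in> carrier_mat n n" "P * Q = 1\<^sub>m n"
  shows "mat_trace (Q * A * P) = mat_trace A"
proof -
  have comm: "mat_trace (X * Y) = mat_trace (Y * X)" if "X \<in> carrier_mat n n" "Y \<in> carrier_mat n n" for X Y :: "'a mat"
    using that sum.swap[of "\<lambda>i k. X $$ (i, k) * Y $$ (k, i)" "{..<n}" "{..<n}"]
    by (simp add: mat_trace_def scalar_prod_def atLeast0LessThan mult.commute)
  have "mat_trace (Q * A * P) = mat_trace (P * (Q * A))" using assms by (intro comm) auto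
  also have "P * (Q * A) = (P * Q) * A" using assms(1-3) by simp
  finally show ?thesis using assms by simp
qed

text \<open>In a basis starting with \<open>v\<close>, \<open>A v\<close> the first column becomes
  \<open>e_1\<close>. The conditions on \<open>v\<close> translate as follows: \<open>r\<close> gets
  a nonzero first entry, and \<open>c\<close>, not being a multiple of \<open>A v\<close>, gets a
  nonzero entry at an index other than 1.\<close>

lemma rooted_of_trace_zero:
  fixes A :: "'a :: field mat"
  assumes big: "\<And>T :: 'a set. finite T \<Longrightarrow> card T \<le> 3 \<Longrightarrow> T \<noteq> UNIV"
    and n: "n \<ge> 2" and A: "A \<in> carrier_mat n n" "mat_trace A = 0" "\<And>a. A \<noteq> a \<cdot>\<^sub>m 1\<^sub>m n" "not_outer n A"
    and c: "c \<in> carrier_vec n" "c \<noteq> 0\<^sub>v n" and r: "r \<in> carrier_vec n" "r \<noteq> 0\<^sub>v n"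
  shows "rooted n A c r"
  using n A c r
proof (induction n arbitrary: A c r rule: less_induct)
  case (less n)
  note n = less.prems(1) and A = less.prems(2) and c = less.prems(6,7) and r = less.prems(8,9)
  let ?e = "unit_vec n :: nat \<Rightarrow> 'a vec"
  obtain v where v: "v \<in> carrier_vec n" "r \<bullet> v \<noteq> 0" "\<And>a. A *\<^sub>v v \<noteq> a \<cdot>\<^sub>v v" "\<And>a. c \<noteq> a \<cdot>\<^sub>v (A *\<^sub>v v)"
    and ker: "(\<forall>y \<in> carrier_vec n. transpose_mat A *\<^sub>v y = 0\<^sub>v n \<longrightarrow> y = 0\<^sub>v n) \<or>
     (\<exists>y \<in> carrier_vec n. transpose_mat A *\<^sub>v y = 0\<^sub>v n \<and> y \<bullet> v \<noteq> 0)"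
    using exists_cyclic_start[OF big A less.prems(4,5) c r] by blast
  have "v \<noteq> 0\<^sub>v n" using v r by auto
  then obtain P Q where PQ: "P \<in> carrier_mat n n" "Q \<in> carrier_mat n n" "P * Q = 1\<^sub>m n" "Q * P = 1\<^sub>m n"
    "P *\<^sub>v ?e 0 = v" "P *\<^sub>v ?e 1 = A *\<^sub>v v"
    using exists_basis_two_columns[OF n v(1) _ _ v(3)] A v by (metis mult_mat_vec_carrier)
  define A' where "A' = Q * A * P"
  have A': "A' \<in> carrier_mat n n" using A PQ by (simp add: A'_def)
  have AA': "A = P * A' * Q"
  proof -
    have "P * A' * Q = (P * Q) * A * (P * Q)"
      unfolding A'_def using A PQ(1,2) by (simp add: assoc_mult_mat[of _ n n _ n _ n])
    then show ?thesis using A PQ by simp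
  qed
  have QA: "Q * A = A' * Q"
  proof -
    have "A' * Q = Q * A * (P * Q)" unfolding A'_def using A PQ(1,2) by (simp add: assoc_mult_mat[of _ n n _ n _ n])
    then show ?thesis using A PQ by simp
  qed
  have QPx: "Q *\<^sub>v (P *\<^sub>v x) = x" "P *\<^sub>v (Q *\<^sub>v x) = x" if "x \<in> carrier_vec n" for x
    using that PQ by (metis assoc_mult_mat_vec one_mult_mat_vec)+
  have "A' *\<^sub>v ?e 0 = Q *\<^sub>v (A *\<^sub>v (P *\<^sub>v ?e 0))"
    unfolding A'_def using A PQ(1,2) by (simp add: assoc_mult_mat_vec[of _ n n _ n])
  also have "\<dots> = ?e 1" using QPx(1)[of "?e 1"] PQ by simp
  finally have A'e: "A' *\<^sub>v ?e 0 = ?e 1" .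
  have col0: "A' $$ (i, 0) = (if i = 1 then 1 else 0)" if "i < n" for i
    using arg_cong[OF A'e, of "\<lambda>x. x $ i"] that n A' by simp
  define c' where "c' = Q *\<^sub>v c"
  have c': "c' \<in> carrier_vec n" using PQ c by (auto simp: c'_def)
  obtain k where k: "k < n" "k \<noteq> 1" "c' $ k \<noteq> 0"
  proof (rule ccontr)
    assume "\<not> thesis"
    with that have "\<And>k. k < n \<Longrightarrow> k \<noteq> 1 \<Longrightarrow> c' $ k = 0" by blast
    then have "c' = c' $ 1 \<cdot>\<^sub>v ?e 1" using c' n by (intro eq_vecI) auto
    then have "c = c' $ 1 \<cdot>\<^sub>v (A *\<^sub>v v)"
      using QPx(2)[OF c(1)] PQ unfolding c'_def by (metis mult_mat_vec unit_vec_carrier)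
    then show False using v by blast
  qed
  define r' where "r' = transpose_mat P *\<^sub>v r"
  have r': "r' \<in> carrier_vec n" using PQ r by (auto simp: r'_def)
  have "r' $ 0 = r' \<bullet> ?e 0" using r' n by simp
  also have "\<dots> = r \<bullet> v" unfolding r'_def using scalar_prod_transpose_mult_vec[of P n n r "?e 0"] PQ r by simp
  finally have r'0: "r' $ 0 \<noteq> 0" using v by simp
  have rr': "r = transpose_mat Q *\<^sub>v r'"
  proof -
    have "transpose_mat Q *\<^sub>v r' = transpose_mat (P * Q) *\<^sub>v r"
      unfolding r'_def using PQ(1,2) r by (simp add: transpose_mult[of _ n n _ n] assoc_mult_mat_vec[of _ n n _ n])
    then show ?thesis using PQ r by simp
  qed
  have tr: "mat_trace A' = 0" using mat_trace_similar[OF A PQ(1-3)] less.prems(3) by (simp add: A'_def)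
  have no: "not_outer n A'" using not_outer_similar[OF less.prems(5) AA' PQ(1,2)] .
  have "rooted n A' c' r'"
  proof (cases "n = 2")
    case True
    \<comment> \<open>Trace zero and the first column \<open>e_1\<close> leave only the entry (0, 1)
      free, and rank two makes it nonzero: \<open>A'\<close> already has the desired shape.\<close>
    have "mat_trace A' = A' $$ (0, 0) + A' $$ (1, 1)" using A' True by (simp add: mat_trace_def numeral_2_eq_2)
    then have a11: "A' $$ (1, 1) = 0" using tr col0[of 0] n by simp
    have a01: "A' $$ (0, 1) \<noteq> 0"
    proof
      assume "A' $$ (0, 1) = 0"
      then have "A' = outer_prod n (?e 1) (?e 0)"
        using A' True col0[of 0] col0[of 1] a11 by (intro eq_matI) (auto simp: outer_prod_def less_2_cases_iff)
      then show False using no unfolding not_outer_def by auto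
    qed
    have "k = 0" using k True by auto
    moreover have "zero_diag_adj_nonzero A'" unfolding zero_diag_adj_nonzero_def
      using A' True a01 a11 col0[of 0] col0[of 1] by (auto simp: less_2_cases_iff)
    ultimately show ?thesis unfolding rooted_def
      using A' c' r' r'0 k n by (intro exI[of _ "1\<^sub>m n"]) auto
  next
    case False
    obtain m where m: "n = Suc m" "m \<ge> 2" using n False by (cases n) auto
    have "\<exists>i<n. 2 \<le> i \<and> (\<exists>j<n. A' $$ (i, j) \<noteq> 0)"
    proof (rule ccontr)
      assume "\<not> ?thesis"
      then have z: "A' $$ (i, j) = 0" if "2 \<le> i" "i < n" "j < n" for i j using that by blast
      have At: "transpose_mat A *\<^sub>v y = transpose_mat Q *\<^sub>v (transpose_mat A' *\<^sub>v (transpose_mat P *\<^sub>v y))" if "y \<in> carrier_vec n" for y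
        unfolding AA' using that A' PQ(1,2) by (simp add: transpose_mult[of _ n n _ n] assoc_mult_mat_vec[of _ n n _ n])
      from ker show False
      proof
        assume inj: "\<forall>y \<in> carrier_vec n. transpose_mat A *\<^sub>v y = 0\<^sub>v n \<longrightarrow> y = 0\<^sub>v n"
        \<comment> \<open>If the rows from 2 on vanish, \<open>e_2\<close> lies in the left kernel
          of \<open>A'\<close>; \<open>y\<close> is the corresponding left kernel vector of
          \<open>A\<close>.\<close>
        define y where "y = transpose_mat Q *\<^sub>v ?e 2"
        have y: "y \<in> carrier_vec n" using PQ by (auto simp: y_def)
        have Py: "transpose_mat P *\<^sub>v y = ?e 2"
        proof -
          have "transpose_mat P *\<^sub>v y = transpose_mat (Q * P) *\<^sub>v ?e 2"
            unfolding y_def using PQ(1,2) by (simp add: transpose_mult[of _ n n _ n] assoc_mult_mat_vec[of _ n n _ n])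
          then show ?thesis using PQ by simp
        qed
        have "transpose_mat A' *\<^sub>v ?e 2 = 0\<^sub>v n" using A' z[of 2] m by (intro eq_vecI) auto
        then have "transpose_mat A *\<^sub>v y = 0\<^sub>v n" using At[OF y] Py PQ by (auto intro!: eq_vecI)
        then have "y = 0\<^sub>v n" using inj y by blast
        moreover have "transpose_mat P *\<^sub>v 0\<^sub>v n = 0\<^sub>v n" using PQ(1) by (intro eq_vecI) auto
        ultimately have "?e 2 = 0\<^sub>v n" using Py by simp
        then show False using m by (metis index_unit_vec(1) index_zero_vec(1) Suc_1 less_Suc_eq_le zero_neq_one)
      next
        assume "\<exists>y \<in> carrier_vec n. transpose_mat A *\<^sub>v y = 0\<^sub>v n \<and> y \<bullet> v \<noteq> 0"
        then obtain y where y: "y \<in> carrier_vec n" "transpose_mat A *\<^sub>v y = 0\<^sub>v n" "y \<bullet> v \<noteq> 0" by blast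
        define y' where "y' = transpose_mat P *\<^sub>v y"
        have y': "y' \<in> carrier_vec n" using y PQ by (auto simp: y'_def)
        have "y' $ 0 = y' \<bullet> ?e 0" using y' n by simp
        also have "\<dots> = y \<bullet> v" unfolding y'_def using scalar_prod_transpose_mult_vec[of P n n y "?e 0"] PQ y by simp
        finally have y'0: "y' $ 0 \<noteq> 0" using y by simp
        have "transpose_mat A' *\<^sub>v y' = transpose_mat (A' * (Q * P)) *\<^sub>v y'" using PQ A' by simp
        also have "\<dots> = transpose_mat P *\<^sub>v (transpose_mat A *\<^sub>v y)"
          using At[OF y(1)] A' PQ(1,2) y' unfolding y'_def[symmetric] by (simp add: transpose_mult[of _ n n _ n] assoc_mult_mat_vec[of _ n n _ n])
        also have "\<dots> = 0\<^sub>v n" using y PQ by (auto intro!: eq_vecI)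
        finally have yA: "transpose_mat A' *\<^sub>v y' = 0\<^sub>v n" .
        \<comment> \<open>Only rows 0 and 1 of \<open>A'\<close> contribute to the relation given by
          \<open>y'\<close>. Column 0, which is \<open>e_1\<close>, yields \<open>y'_1 = 0\<close>;
          as \<open>y'_0\<close> is nonzero, row 0 vanishes and \<open>A'\<close> has rank at most
          one.\<close>
        have col_eq: "A' $$ (0, j) * y' $ 0 + A' $$ (1, j) * y' $ 1 = 0" if "j < n" for j
        proof -
          obtain m' where m': "n = Suc (Suc m')" using m by (cases m) auto
          have "0 = (transpose_mat A' *\<^sub>v y') $ j" using yA that by simp
          also have "\<dots> = (\<Sum>l<n. A' $$ (l, j) * y' $ l)"
            using that A' y' by (auto simp: scalar_prod_def atLeast0LessThan intro!: sum.cong)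
          also have "\<dots> = A' $$ (0, j) * y' $ 0 + A' $$ (1, j) * y' $ 1"
            using z that unfolding m' by (simp add: sum.lessThan_Suc_shift del: sum.lessThan_Suc)
          finally show ?thesis by simp
        qed
        have "y' $ 1 = 0" using col_eq[of 0] col0[of 0] col0[of 1] n by simp
        then have z0: "A' $$ (0, j) = 0" if "j < n" for j using col_eq[OF that] y'0 by simp
        have "A' = outer_prod n (?e 1) (row A' 1)"
        proof (rule eq_matI)
          fix i j assume "i < dim_row (outer_prod n (?e 1) (row A' 1))" "j < dim_col (outer_prod n (?e 1) (row A' 1))"
          then have ij: "i < n" "j < n" by (auto simp: outer_prod_def)
          consider "i = 0" | "i = 1" | "i \<ge> 2" by linarith
          then show "A' $$ (i, j) = outer_prod n (?e 1) (row A' 1) $$ (i, j)"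
            using ij n z z0 A' by cases (auto simp: outer_prod_def)
        qed (use A' in \<open>auto simp: outer_prod_def\<close>)
        then show False using no A' n unfolding not_outer_def by (metis row_carrier_vec carrier_matD(1) carrier_matD(2) unit_vec_carrier Suc_1 Suc_le_lessD)
      qed
    qed
    then obtain i j where ij: "2 \<le> i" "i < n" "j < n" "A' $$ (i, j) \<noteq> 0" by blast
    have IH: "rooted m B c r" if "B \<in> carrier_mat m m" "mat_trace B = 0" "\<And>a. B \<noteq> a \<cdot>\<^sub>m 1\<^sub>m m" "not_outer m B"
      "c \<in> carrier_vec m" "c \<noteq> 0\<^sub>v m" "r \<in> carrier_vec m" "r \<noteq> 0\<^sub>v m" for B :: "'a mat" and c r
      using less.IH[of m B c r] that m by blast
    show ?thesis unfolding m(1)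
      by (rule rooted_of_cyclic_column[OF big, where i = i and j = j and k = k])
        (use A' m(2) col0 tr ij c' k r' r'0 in \<open>(simp add: m(1) IH)+\<close>)
  qed
  then show ?case using rooted_conj[OF A A' PQ(1,2,3,4) QA c(1) r' rr'] n by (simp add: c'_def)
qed

section \<open>The field with three elements\<close>

definition block_diag :: "nat \<Rightarrow> nat \<Rightarrow> 'a :: zero mat \<Rightarrow> (nat \<Rightarrow> 'a) \<Rightarrow> 'a mat" where
  "block_diag k m H d = mat (k + m) (k + m)
     (\<lambda>(i, j). if i < k \<and> j < k then H $$ (i, j) else if i = j then d (i - k) else 0)"

lemma block_diag_carrier [simp]: "block_diag k m H d \<in> carrier_mat (k + m) (k + m)"
  by (simp add: block_diag_def)

lemma block_diag_mult:
  fixes H H' :: "'a :: semiring_0 mat"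
  assumes "H \<in> carrier_mat k k" "H' \<in> carrier_mat k k"
  shows "block_diag k m H d * block_diag k m H' d' = block_diag k m (H * H') (\<lambda>i. d i * d' i)"
proof (rule eq_matI)
  fix i j assume "i < dim_row (block_diag k m (H * H') (\<lambda>i. d i * d' i))" "j < dim_col (block_diag k m (H * H') (\<lambda>i. d i * d' i))"
  then have ij: "i < k + m" "j < k + m" by (auto simp: block_diag_def)
  have "(block_diag k m H d * block_diag k m H' d') $$ (i, j) =
      (\<Sum>l<k. block_diag k m H d $$ (i, l) * block_diag k m H' d' $$ (l, j)) +
      (\<Sum>l=k..<k + m. block_diag k m H d $$ (i, l) * block_diag k m H' d' $$ (l, j))"
  proof -
    have "(block_diag k m H d * block_diag k m H' d') $$ (i, j) =
      (\<Sum>l=0..<k + m. block_diag k m H d $$ (i, l) * block_diag k m H' d' $$ (l, j))"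
      using ij block_diag_carrier[of k m H d] block_diag_carrier[of k m H' d'] by (simp add: scalar_prod_def del: block_diag_carrier)
    then show ?thesis by (simp add: sum.atLeastLessThan_concat atLeast0LessThan[symmetric])
  qed
  also have "(\<Sum>l<k. block_diag k m H d $$ (i, l) * block_diag k m H' d' $$ (l, j)) = (if i < k \<and> j < k then (H * H') $$ (i, j) else 0)"
    using ij assms by (auto simp: block_diag_def scalar_prod_def atLeast0LessThan intro!: sum.cong sum.neutral)
  also have "(\<Sum>l=k..<k + m. block_diag k m H d $$ (i, l) * block_diag k m H' d' $$ (l, j)) =
      (\<Sum>l=k..<k + m. if l = i then (if i = j then d (i - k) * d' (i - k) else 0) else 0)"
    using ij by (intro sum.cong) (auto simp: block_diag_def)
  also have "\<dots> = (if k \<le> i \<and> i = j then d (i - k) * d' (i - k) else 0)" using ij by simp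
  finally show "(block_diag k m H d * block_diag k m H' d') $$ (i, j) = block_diag k m (H * H') (\<lambda>i. d i * d' i) $$ (i, j)"
    using ij by (auto simp: block_diag_def)
qed (auto simp: block_diag_def)

lemma block_diag_one: "block_diag k m (1\<^sub>m k) (\<lambda>_. 1) = 1\<^sub>m (k + m)"
  by (rule eq_matI) (auto simp: block_diag_def)

text \<open>The leading zero is the last diagonal entry of a block built before. The attached column
  and row are what that block leaves over, which is supported at this entry alone.\<close>

definition extends_at_zero :: "nat \<Rightarrow> (nat \<Rightarrow> 'a :: field) \<Rightarrow> bool" where
  "extends_at_zero m d \<longleftrightarrow> (\<forall>a b. a \<noteq> 0 \<longrightarrow> b \<noteq> 0 \<longrightarrow>
     rooted (Suc m) (mat_diag (Suc m) (case_nat 0 d)) (a \<cdot>\<^sub>v unit_vec (Suc m) 0) (b \<cdot>\<^sub>v unit_vec (Suc m) 0))"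

lemma rooted_block_chain:
  fixes H :: "'a :: field mat"
  assumes "H \<in> carrier_mat (Suc k) (Suc k)" "zero_diag_adj_nonzero H"
    and "c \<in> carrier_vec (Suc k + m)" "c $ 0 \<noteq> 0" "\<And>i. k < i \<Longrightarrow> i < Suc k + m \<Longrightarrow> c $ i = 0"
    and "r \<in> carrier_vec (Suc k + m)" "r $ 0 \<noteq> 0" "\<And>i. k < i \<Longrightarrow> i < Suc k + m \<Longrightarrow> r $ i = 0"
    and d: "extends_at_zero m d"
  shows "rooted (Suc k + m) (block_diag (Suc k) m H d) c r"
  using assms(1-8)
proof (induction k arbitrary: H c r)
  case 0
  have "block_diag (Suc 0) m H d = mat_diag (Suc m) (case_nat 0 d)"
    using 0(1,2) by (intro eq_matI) (auto simp: block_diag_def mat_diag_def zero_diag_adj_nonzero_def split: nat.split)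
  moreover have "c = c $ 0 \<cdot>\<^sub>v unit_vec (Suc m) 0" "r = r $ 0 \<cdot>\<^sub>v unit_vec (Suc m) 0"
    using 0 by (auto intro!: eq_vecI)
  ultimately show ?case using d 0(4,7) unfolding extends_at_zero_def by (metis add_Suc add_0)
next
  case (Suc k)
  let ?B = "block_diag (Suc (Suc k)) m H d"
  have B: "?B \<in> carrier_mat (Suc (Suc k + m)) (Suc (Suc k + m))" using block_diag_carrier[of "Suc (Suc k)" m H d] by simp
  have tr: "trailing ?B = block_diag (Suc k) m (trailing H) d"
    using Suc.prems(1) by (intro eq_matI) (auto simp: block_diag_def trailing_def)
  have H: "H $$ (i, i) = 0" if "i < Suc (Suc k)" for i
    using Suc.prems(1,2) that by (auto simp: zero_diag_adj_nonzero_def)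
  have H': "H $$ (i, Suc i) \<noteq> 0" "H $$ (Suc i, i) \<noteq> 0" if "Suc i < Suc (Suc k)" for i
    using Suc.prems(1,2) that by (auto simp: zero_diag_adj_nonzero_def)
  have "rooted (Suc (Suc k + m)) ?B c r"
  proof (rule rooted_peel[OF B])
    show "rooted (Suc k + m) (trailing ?B) (trailing_col ?B) (trailing_row ?B)"
      unfolding tr
    proof (rule Suc.IH)
      show "trailing H \<in> carrier_mat (Suc k) (Suc k)" using Suc.prems(1) by simp
      show "zero_diag_adj_nonzero (trailing H)" unfolding zero_diag_adj_nonzero_def
        using Suc.prems(1) H H' by (auto simp: trailing_def)
      show "trailing_col ?B $ 0 \<noteq> 0" "trailing_row ?B $ 0 \<noteq> 0" using H'[of 0] by (simp_all add: trailing_col_def trailing_row_def block_diag_def)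
    qed (use B in \<open>auto simp: trailing_col_def trailing_row_def block_diag_def\<close>)
  qed (use Suc.prems H[of 0] in \<open>auto simp: block_diag_def\<close>)
  then show ?case by simp
qed

text \<open>Extend \<open>T\<close> by the identity to replace \<open>K\<close> by \<open>H\<close>,
  then run the chain. The column becomes a multiple of the first column of \<open>T\<close> and the
  row one of the first row of \<open>S\<close>, whence the conditions on the two corner
  entries.\<close>

lemma rooted_block_conj:
  fixes H K :: "'a :: field mat"
  assumes S: "S \<in> carrier_mat k k" and T: "T \<in> carrier_mat k k" and ST: "S * T = 1\<^sub>m k" "T * S = 1\<^sub>m k"
    and K: "K \<in> carrier_mat k k" and H: "H \<in> carrier_mat k k" and eq: "T * K = H * T" and z: "zero_diag_adj_nonzero H"
    and k: "k > 0" and nz: "T $$ (0, 0) \<noteq> 0" "S $$ (0, 0) \<noteq> 0" "a \<noteq> 0" "b \<noteq> 0"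
    and d: "extends_at_zero m d"
  shows "rooted (k + m) (block_diag k m K d) (a \<cdot>\<^sub>v unit_vec (k + m) 0) (b \<cdot>\<^sub>v unit_vec (k + m) 0)"
proof -
  let ?n = "k + m" let ?S = "block_diag k m S (\<lambda>_. 1)" let ?T = "block_diag k m T (\<lambda>_. 1)"
  have ST': "?S * ?T = 1\<^sub>m ?n" "?T * ?S = 1\<^sub>m ?n" using S T ST by (simp_all add: block_diag_mult block_diag_one)
  have eq': "?T * block_diag k m K d = block_diag k m H d * ?T" using T K H eq by (simp add: block_diag_mult)
  define r' where "r' = transpose_mat ?S *\<^sub>v (b \<cdot>\<^sub>v unit_vec ?n 0)"
  have r': "r' \<in> carrier_vec ?n" unfolding r'_def by (intro mult_mat_vec_carrier[of _ ?n ?n]) auto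
  have r'_nth: "r' $ i = (if i < k then b * S $$ (0, i) else 0)" if "i < ?n" for i
    unfolding r'_def using that k by (simp add: mult_mat_vec[of _ ?n ?n]) (simp add: block_diag_def)
  have Tc_nth: "(?T *\<^sub>v (a \<cdot>\<^sub>v unit_vec ?n 0)) $ i = (if i < k then a * T $$ (i, 0) else 0)" if "i < ?n" for i
    using that k by (simp add: mult_mat_vec[of _ ?n ?n]) (simp add: block_diag_def)
  have r: "b \<cdot>\<^sub>v unit_vec ?n 0 = transpose_mat ?T *\<^sub>v r'"
  proof -
    have "transpose_mat ?T *\<^sub>v r' = transpose_mat (?S * ?T) *\<^sub>v (b \<cdot>\<^sub>v unit_vec ?n 0)"
      unfolding r'_def by (simp add: transpose_mult[of _ ?n ?n _ ?n] assoc_mult_mat_vec[of _ ?n ?n _ ?n])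
    then show ?thesis using ST' by simp
  qed
  obtain k' where k': "k = Suc k'" using k by (cases k) auto
  have "?T *\<^sub>v (a \<cdot>\<^sub>v unit_vec ?n 0) \<in> carrier_vec ?n" by (intro mult_mat_vec_carrier[of _ ?n ?n]) auto
  then have "rooted ?n (block_diag k m H d) (?T *\<^sub>v (a \<cdot>\<^sub>v unit_vec ?n 0)) r'"
    using H z d nz r' r'_nth Tc_nth unfolding k' by (intro rooted_block_chain) auto
  then show ?thesis using k by (intro rooted_conj[OF _ _ _ _ ST' eq' _ r' r]) auto
qed

section \<open>Reordering the diagonal\<close>

lemma rooted_diag_permute:
  fixes d :: "nat \<Rightarrow> 'a :: field"
  assumes p: "bij_betw p {..<n} {..<n}" and n: "n > 0"
    and c: "c \<in> carrier_vec n" and r: "r \<in> carrier_vec n"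
    and rt: "rooted n (mat_diag n (d \<circ> p)) (vec n (\<lambda>i. c $ p i)) (vec n (\<lambda>i. r $ p i))"
  shows "rooted n (mat_diag n d) c r"
proof -
  define T :: "'a mat" where "T = mat n n (\<lambda>(i, j). if j = p i then 1 else 0)"
  have T: "T \<in> carrier_mat n n" by (simp add: T_def)
  have pn: "p i < n" if "i < n" for i using p that by (auto simp: bij_betw_def)
  have inj: "p i = p j \<longleftrightarrow> i = j" if "i < n" "j < n" for i j using p that by (auto simp: bij_betw_def inj_on_def)
  have 1: "T * transpose_mat T = 1\<^sub>m n"
    using pn by (intro eq_matI) (auto simp: T_def scalar_prod_def inj if_distrib[of "\<lambda>x. x * _"] cong: if_cong)
  then have 2: "transpose_mat T * T = 1\<^sub>m n" using mat_mult_left_right_inverse[of T n "transpose_mat T"] T by simp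
  have eq: "T * mat_diag n d = mat_diag n (d \<circ> p) * T"
    using T pn by (simp add: mat_diag_mult_right[of _ n n] mat_diag_mult_left[of _ n n]) (auto simp: T_def)
  have Tv: "T *\<^sub>v x = vec n (\<lambda>i. x $ p i)" if "x \<in> carrier_vec n" for x
    using that pn by (intro eq_vecI) (auto simp: T_def scalar_prod_def if_distrib[of "\<lambda>x. x * _"] cong: if_cong)
  have rr: "r = transpose_mat T *\<^sub>v vec n (\<lambda>i. r $ p i)"
  proof -
    have "transpose_mat T *\<^sub>v (T *\<^sub>v r) = r" using 2 T r by (metis assoc_mult_mat_vec one_mult_mat_vec transpose_carrier_mat)
    then show ?thesis using Tv[OF r] by simp
  qed
  show ?thesis using rooted_conj[OF _ _ _ T 2 1 eq c _ rr _ n] rt Tv[OF c] T by simp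
qed

lemma extends_at_zero_permute:
  assumes "mset ds = mset ds'" "extends_at_zero (length ds') ((!) ds')"
  shows "extends_at_zero (length ds) ((!) ds)"
proof -
  obtain p where p: "p permutes {..<length ds}" "permute_list p ds = ds'"
    using mset_eq_permutation[of ds' ds] assms(1) by auto
  have len: "length ds' = length ds" using assms(1) mset_eq_length by metis
  let ?n = "Suc (length ds)"
  \<comment> \<open>The leading zero stays in place and \<open>p\<close> acts on the rest, shifted
    by one; multiples of \<open>e_0\<close> are therefore preserved.\<close>
  define q where "q = case_nat 0 (Suc \<circ> p)"
  have pn: "p i < length ds" if "i < length ds" for i using p(1) that permutes_in_image by fastforce
  have inj: "inj p" using p(1) permutes_inj by blast
  have "inj_on q {..<?n}" by (auto simp: inj_on_def q_def inj_eq[OF inj] split: nat.splits)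
  moreover have "q ` {..<?n} \<subseteq> {..<?n}" using pn by (auto simp: q_def split: nat.splits)
  ultimately have q: "bij_betw q {..<?n} {..<?n}"
    by (simp add: bij_betw_def endo_inj_surj)
  have qv: "vec ?n (\<lambda>i. (a \<cdot>\<^sub>v unit_vec ?n 0) $ q i) = a \<cdot>\<^sub>v unit_vec ?n 0" for a :: 'a
    using pn by (intro eq_vecI) (auto simp: q_def split: nat.splits)
  have qd: "mat_diag ?n (case_nat 0 ((!) ds) \<circ> q) = mat_diag ?n (case_nat 0 ((!) ds'))"
    using p by (intro eq_matI) (auto simp: mat_diag_def q_def permute_list_nth split: nat.splits)
  show ?thesis unfolding extends_at_zero_def
  proof (intro allI impI)
    fix a b :: 'a assume "a \<noteq> 0" "b \<noteq> 0"
    then have "rooted ?n (mat_diag ?n (case_nat 0 ((!) ds'))) (a \<cdot>\<^sub>v unit_vec ?n 0) (b \<cdot>\<^sub>v unit_vec ?n 0)"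
      using assms(2) unfolding extends_at_zero_def len by blast
    then show "rooted ?n (mat_diag ?n (case_nat 0 ((!) ds))) (a \<cdot>\<^sub>v unit_vec ?n 0) (b \<cdot>\<^sub>v unit_vec ?n 0)"
      using rooted_diag_permute[OF q, where c = "a \<cdot>\<^sub>v unit_vec ?n 0" and r = "b \<cdot>\<^sub>v unit_vec ?n 0" and d = "case_nat 0 ((!) ds)"]
      unfolding qv qd by simp
  qed
qed

section \<open>Explicit blocks in characteristic three\<close>

lemma mat_diag_append:
  "mat_diag (length ps + length ds) ((!) (ps @ ds)) = block_diag (length ps) (length ds) (mat_diag (length ps) ((!) ps)) ((!) ds)"
  by (rule eq_matI) (auto simp: mat_diag_def block_diag_def nth_append)

lemma case_nat_nth: "case_nat x ((!) xs) = (!) (x # xs)"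
  by (rule ext) (simp add: nth_Cons)

lemma extends_at_zero_Nil: "extends_at_zero 0 d"
  unfolding extends_at_zero_def rooted_def zero_diag_adj_nonzero_def
  by (intro allI impI exI[of _ "1\<^sub>m (Suc 0)"]) (auto simp: mat_diag_def)

text \<open>The skew-symmetric tridiagonal matrix \<open>?H\<close> has characteristic polynomial
  \<open>X^3 + 2 X\<close>, which is \<open>X^3 - X\<close> in characteristic three. The columns of
  \<open>?T\<close> are its eigenvectors for 0, 1 and -1.\<close>

lemma extends_at_zero_pair:
  fixes ds :: "'a :: field list"
  assumes three: "(1 :: 'a) + 1 + 1 = 0" and d: "extends_at_zero (length ds) ((!) ds)"
  shows "extends_at_zero (length (1 # -1 # ds)) ((!) (1 # -1 # ds))"
proof -
  have two: "(2 :: 'a) = -1" "(1 :: 'a) + 1 = -1" using three by (auto simp: eq_neg_iff_add_eq_0)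
  let ?M = "mat_of_rows_list 3 :: 'a list list \<Rightarrow> 'a mat"
  let ?T = "?M [[1, 1, 1], [0, 1, -1], [1, -1, -1]]" and ?S = "?M [[-1, 0, -1], [1, -1, -1], [1, 1, -1]]"
  let ?K = "mat_diag 3 ((!) [0, 1, -1]) :: 'a mat" and ?H = "?M [[0, 1, 0], [-1, 0, 1], [0, -1, 0]]"
  have carr: "?S \<in> carrier_mat 3 3" "?T \<in> carrier_mat 3 3" "?K \<in> carrier_mat 3 3" "?H \<in> carrier_mat 3 3"
    by (auto simp: mat_of_rows_list_def mat_diag_def)
  have ST: "?S * ?T = 1\<^sub>m 3"
    by (rule eq_matI) (auto simp: mat_of_rows_list_def mat_diag_def scalar_prod_def less_Suc_eq eval_nat_numeral two)
  have TS: "?T * ?S = 1\<^sub>m 3"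
    by (rule eq_matI) (auto simp: mat_of_rows_list_def mat_diag_def scalar_prod_def less_Suc_eq eval_nat_numeral two)
  have TK: "?T * ?K = ?H * ?T"
    by (rule eq_matI) (auto simp: mat_of_rows_list_def mat_diag_def scalar_prod_def less_Suc_eq eval_nat_numeral two)
  have z: "zero_diag_adj_nonzero ?H"
    unfolding zero_diag_adj_nonzero_def by (auto simp: mat_of_rows_list_def less_Suc_eq eval_nat_numeral)
  have diag: "mat_diag (Suc (length (1 # -1 # ds))) (case_nat 0 ((!) (1 # -1 # ds))) = block_diag 3 (length ds) ?K ((!) ds)"
    using mat_diag_append[of "[0, 1, -1]" ds] unfolding case_nat_nth by (simp add: eval_nat_numeral)
  have "?T $$ (0, 0) \<noteq> 0" "?S $$ (0, 0) \<noteq> 0" by (simp_all add: mat_of_rows_list_def)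
  moreover have "Suc (length (1 # -1 # ds)) = 3 + length ds" by simp
  ultimately show ?thesis unfolding extends_at_zero_def diag
    using rooted_block_conj[OF carr(1,2) ST TS carr(3,4) TK z _ _ _ _ _ d] by (metis zero_less_numeral)
qed

text \<open>Since \<open>4 = 1\<close>, the all-ones matrix \<open>E\<close> of size 4 is idempotent of rank one, so \<open>a (1 - E)\<close> is similar
  to \<open>diag(0, a, a, a)\<close>.\<close>

lemma extends_at_zero_triple:
  fixes ds :: "'a :: field list"
  assumes three: "(1 :: 'a) + 1 + 1 = 0" and a: "a \<noteq> 0" and d: "extends_at_zero (length ds) ((!) ds)"
  shows "extends_at_zero (length (a # a # a # ds)) ((!) (a # a # a # ds))"
proof -
  have two: "(2 :: 'a) = -1" "(1 :: 'a) + 1 = -1" using three by (auto simp: eq_neg_iff_add_eq_0)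
  have aa: "a + a = - a" "a + (a + a) = 0" using arg_cong[OF two(2), of "\<lambda>x. a * x"] by (simp_all add: distrib_left)
  let ?M = "mat_of_rows_list 4 :: 'a list list \<Rightarrow> 'a mat"
  let ?S = "?M [[1, 1, 1, 1], [1, -1, 0, 0], [1, 0, -1, 0], [1, 0, 0, -1]]"
  \<comment> \<open>The first column spans the image of \<open>E\<close>; the other three have
    coordinate sum 3 = 0 and span its kernel.\<close>
  let ?T = "?M [[1, 1, 1, 1], [1, 0, 1, 1], [1, 1, 0, 1], [1, 1, 1, 0]]"
  let ?K = "mat_diag 4 ((!) [0, a, a, a]) :: 'a mat"
  let ?H = "?M [[0, -a, -a, -a], [-a, 0, -a, -a], [-a, -a, 0, -a], [-a, -a, -a, 0]]"
  have carr: "?S \<in> carrier_mat 4 4" "?T \<in> carrier_mat 4 4" "?K \<in> carrier_mat 4 4" "?H \<in> carrier_mat 4 4"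
    by (auto simp: mat_of_rows_list_def mat_diag_def)
  have ST: "?S * ?T = 1\<^sub>m 4"
    by (rule eq_matI) (auto simp: mat_of_rows_list_def mat_diag_def scalar_prod_def less_Suc_eq eval_nat_numeral two)
  have TS: "?T * ?S = 1\<^sub>m 4"
    by (rule eq_matI) (auto simp: mat_of_rows_list_def mat_diag_def scalar_prod_def less_Suc_eq eval_nat_numeral two)
  have TK: "?T * ?K = ?H * ?T"
    by (rule eq_matI) (auto simp: mat_of_rows_list_def mat_diag_def scalar_prod_def less_Suc_eq eval_nat_numeral two aa)
  have z: "zero_diag_adj_nonzero ?H"
    unfolding zero_diag_adj_nonzero_def using a by (auto simp: mat_of_rows_list_def less_Suc_eq eval_nat_numeral)
  have diag: "mat_diag (Suc (length (a # a # a # ds))) (case_nat 0 ((!) (a # a # a # ds))) = block_diag 4 (length ds) ?K ((!) ds)"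
    using mat_diag_append[of "[0, a, a, a]" ds] unfolding case_nat_nth by (simp add: eval_nat_numeral)
  have "?T $$ (0, 0) \<noteq> 0" "?S $$ (0, 0) \<noteq> 0" by (simp_all add: mat_of_rows_list_def)
  moreover have "Suc (length (a # a # a # ds)) = 4 + length ds" by simp
  ultimately show ?thesis unfolding extends_at_zero_def diag
    using rooted_block_conj[OF carr(1,2) ST TS carr(3,4) TK z _ _ _ _ _ d] by (metis zero_less_numeral)
qed

lemma mset_remove_pair:
  assumes "a \<in> set ds" "b \<in> set ds" "a \<noteq> b"
  shows "mset (a # b # remove1 b (remove1 a ds)) = mset ds"
proof -
  obtain M where "mset ds = add_mset a M" using assms(1) by (metis insert_DiffM set_mset_mset)
  moreover from this obtain N where "M = add_mset b N"
    using assms(2,3) by (metis insert_DiffM set_mset_mset insert_noteq_member)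
  ultimately show ?thesis by simp
qed

text \<open>If both signs occur, remove a pair. Otherwise all entries equal one \<open>a\<close>,
  and the zero sum leaves room for a triple. Either removal preserves the zero sum.\<close>

lemma extends_at_zero_signs:
  fixes ds :: "'a :: field list"
  assumes three: "(1 :: 'a) + 1 + 1 = 0"
  shows "set ds \<subseteq> {1, -1} \<Longrightarrow> sum_list ds = 0 \<Longrightarrow> extends_at_zero (length ds) ((!) ds)"
proof (induction "length ds" arbitrary: ds rule: less_induct)
  case less
  have two: "(1 :: 'a) + 1 = -1" using three by (auto simp: eq_neg_iff_add_eq_0)
  have n11: "(1 :: 'a) \<noteq> -1" using two by (metis add_cancel_right_right one_neq_zero)
  consider "ds = []" | "1 \<in> set ds" "-1 \<in> set ds" | a where "ds \<noteq> []" "set ds = {a}" "a \<in> {1, -1}"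
  proof -
    have "set ds = {} \<or> set ds = {1} \<or> set ds = {-1} \<or> (1 \<in> set ds \<and> -1 \<in> set ds)" using less.prems(1)
      by (cases "1 \<in> set ds"; cases "- 1 \<in> set ds"; cases ds) auto
    then show thesis using that by fastforce
  qed
  then show ?case
  proof cases
    case 1 then show ?thesis by (simp add: extends_at_zero_Nil)
  next
    case 2
    define es where "es = remove1 (-1) (remove1 1 ds)"
    have m: "mset (1 # -1 # es) = mset ds" unfolding es_def using 2 n11 by (intro mset_remove_pair) auto
    have e: "sum_list (1 # -1 # es) = sum_list ds" "set (1 # -1 # es) = set ds" "length (1 # -1 # es) = length ds"
      using m by (metis sum_mset_sum_list, metis set_mset_mset, metis size_mset)
    have "length es < length ds" using e(3) by simp
    moreover have "set es \<subseteq> {1, -1}" using e(2) less.prems(1) by (metis insert_subset list.set(2))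
    moreover have "sum_list es = 0" using e(1) less.prems(2) by simp
    ultimately have "extends_at_zero (length es) ((!) es)" by (rule less.hyps)
    then show ?thesis using extends_at_zero_permute[OF m[symmetric]] extends_at_zero_pair[OF three] by blast
  next
    case 3
    have a0: "a \<noteq> 0" "a + a \<noteq> 0" using 3(3) two n11 by auto
    have rep: "ds = replicate (length ds) a" using 3 by (metis replicate_length_same singletonD)
    have "length ds \<noteq> 0" using 3 by auto
    \<comment> \<open>One or two copies of \<open>a\<close> would sum to \<open>a\<close> or
      \<open>2 a\<close>, both nonzero.\<close>
    moreover have "length ds \<noteq> 1" "length ds \<noteq> 2"
      using rep less.prems(2) a0 by (auto simp: numeral_2_eq_2)
    ultimately obtain k where k: "length ds = Suc (Suc (Suc k))"
      by (metis One_nat_def Suc_1 not0_implies_Suc)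
    define es where "es = replicate k a"
    have ds: "ds = a # a # a # es" using rep unfolding k es_def by simp
    have "a + a + a = a * (1 + 1 + 1)" by (simp add: distrib_left)
    then have "a + a + a = 0" using three by simp
    moreover have "sum_list ds = (a + a + a) + sum_list es" unfolding ds by (simp add: add.assoc)
    ultimately have "sum_list es = 0" using less.prems(2) by (metis add_0)
    then have "extends_at_zero (length es) ((!) es)" using less(1)[of es] less.prems(1) unfolding ds by auto
    then show ?thesis using extends_at_zero_triple[OF three a0(1)] unfolding ds by blast
  qed
qed

text \<open>There is no leading zero at the start, so the first block is \<open>diag(1, -1)\<close>,
  similar to the exchange matrix \<open>?H\<close>. Its final zero is where the remaining entries,
  again of sum zero, are attached.\<close>

lemma rooted_signs:
  fixes ds :: "'a :: field list"
  assumes three: "(1 :: 'a) + 1 + 1 = 0" and ds: "set ds = {1, -1}" "sum_list ds = 0"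
  shows "\<exists>c r. rooted (length ds) (mat_diag (length ds) ((!) ds)) c r"
proof -
  have two: "(2 :: 'a) = -1" "(1 :: 'a) + 1 = -1" using three by (auto simp: eq_neg_iff_add_eq_0)
  have n11: "(1 :: 'a) \<noteq> -1" using two by (metis add_cancel_right_right one_neq_zero)
  define es where "es = remove1 (-1) (remove1 1 ds)"
  have m: "mset (1 # -1 # es) = mset ds" unfolding es_def using ds n11 by (intro mset_remove_pair) auto
  have "sum_list (1 # -1 # es) = sum_list ds" "set (1 # -1 # es) = set ds"
    using m by (metis sum_mset_sum_list, metis set_mset_mset)
  then have es: "extends_at_zero (length es) ((!) es)" using extends_at_zero_signs[OF three, of es] ds by auto
  let ?M = "mat_of_rows_list 2 :: 'a list list \<Rightarrow> 'a mat"
  let ?S = "?M [[1, 1], [1, -1]]" and ?T = "?M [[-1, -1], [-1, 1]]"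
  let ?K = "mat_diag 2 ((!) [1, -1]) :: 'a mat" and ?H = "?M [[0, 1], [1, 0]]"
  have carr: "?S \<in> carrier_mat 2 2" "?T \<in> carrier_mat 2 2" "?K \<in> carrier_mat 2 2" "?H \<in> carrier_mat 2 2"
    by (auto simp: mat_of_rows_list_def mat_diag_def)
  have ST: "?S * ?T = 1\<^sub>m 2"
    by (rule eq_matI) (auto simp: mat_of_rows_list_def mat_diag_def scalar_prod_def less_Suc_eq eval_nat_numeral two)
  have TS: "?T * ?S = 1\<^sub>m 2"
    by (rule eq_matI) (auto simp: mat_of_rows_list_def mat_diag_def scalar_prod_def less_Suc_eq eval_nat_numeral two)
  have TK: "?T * ?K = ?H * ?T"
    by (rule eq_matI) (auto simp: mat_of_rows_list_def mat_diag_def scalar_prod_def less_Suc_eq eval_nat_numeral two)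
  have z: "zero_diag_adj_nonzero ?H"
    unfolding zero_diag_adj_nonzero_def by (auto simp: mat_of_rows_list_def less_Suc_eq eval_nat_numeral)
  let ?n = "2 + length es" let ?e = "unit_vec ?n 0 :: 'a vec"
  have diag: "mat_diag ?n ((!) (1 # -1 # es)) = block_diag 2 (length es) ?K ((!) es)"
    using mat_diag_append[of "[1, -1]" es] by (simp add: eval_nat_numeral)
  have rt: "rooted ?n (mat_diag ?n ((!) (1 # -1 # es))) ?e ?e"
    using rooted_block_conj[OF carr(1,2) ST TS carr(3,4) TK z _ _ _ one_neq_zero one_neq_zero es] unfolding diag by (auto simp: mat_of_rows_list_def)
  have len: "length ds = ?n" using arg_cong[OF m, of size] by simp
  obtain p where p: "p permutes {..<?n}" "permute_list p ds = 1 # -1 # es"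
    using mset_eq_permutation[OF m] len by auto
  have bij: "bij_betw p {..<?n} {..<?n}" using p(1) permutes_imp_bij by blast
  have "mat_diag ?n ((!) ds \<circ> p) = mat_diag ?n ((!) (1 # -1 # es))"
    using p len by (intro eq_matI) (auto simp: mat_diag_def permute_list_nth simp flip: p(2))
  \<comment> \<open>The unit vector at \<open>p 0\<close> is the one that the reordering moves to
    position 0.\<close>
  moreover have "vec ?n (\<lambda>i. (unit_vec ?n (p 0) :: 'a vec) $ p i) = ?e"
  proof (rule eq_vecI)
    fix i assume "i < dim_vec ?e"
    then have "p i < ?n" "p 0 < ?n" "p i = p 0 \<longleftrightarrow> i = 0"
      using p(1) by (auto simp: permutes_in_image inj_eq[OF permutes_inj[OF p(1)]] dest: permutes_in_image[where x = i] permutes_in_image[where x = 0])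
    then show "vec ?n (\<lambda>i. (unit_vec ?n (p 0) :: 'a vec) $ p i) $ i = ?e $ i" using \<open>i < dim_vec ?e\<close> by auto
  qed simp
  ultimately show ?thesis
    using rooted_diag_permute[OF bij, of "unit_vec ?n (p 0)" "unit_vec ?n (p 0)" "(!) ds"] rt len by auto
qed

section \<open>Small fields, spectra and the combination of both cases\<close>

lemma small_field_cases:
  assumes "finite (UNIV :: 'a :: field set)" "card (UNIV :: 'a set) \<le> 3"
  shows "(x :: 'a) \<in> {0, 1, -1}"
proof (rule ccontr)
  assume x: "x \<notin> {0, 1, -1}"
  \<comment> \<open>A fourth element besides 0, 1 and \<open>x\<close>; in characteristic two -1
    coincides with 1, and \<open>x + 1\<close> takes its place.\<close>
  define y where "y = (if (1 :: 'a) = -1 then x + 1 else -1)"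
  have "y \<notin> {0, 1, x}" using x by (auto simp: y_def add_eq_0_iff2)
  then have "card {0, 1, x, y} = 4" using x by auto
  moreover have "card {0, 1, x, y} \<le> card (UNIV :: 'a set)" using assms(1) by (intro card_mono) auto
  ultimately show False using assms(2) by simp
qed

lemma invertible_mat_mult_vec_zero:
  fixes J :: "'a :: field mat"
  assumes "J \<in> carrier_mat n n" "invertible_mat J" "x \<in> carrier_vec n" "J *\<^sub>v x = 0\<^sub>v n"
  shows "x = 0\<^sub>v n"
proof -
  obtain B where B: "inverts_mat J B" "inverts_mat B J" using assms(2) unfolding invertible_mat_def by blast
  have Bc: "B \<in> carrier_mat n n"
    using B assms(1) unfolding inverts_mat_def by (metis carrier_mat_triv carrier_matD index_mult_mat(2,3) index_one_mat(2,3))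
  then have "x = (B * J) *\<^sub>v x" using B(2) assms(1,3) by (simp add: inverts_mat_def)
  also have "\<dots> = B *\<^sub>v (J *\<^sub>v x)" using Bc assms by (simp add: assoc_mult_mat_vec[of _ n n _ n])
  finally show ?thesis using Bc assms(4) by (auto intro!: eq_vecI)
qed

lemma spectrum_of_scalar_mat:
  fixes a :: "'a :: field"
  assumes "b \<in> spectrum (a \<cdot>\<^sub>m 1\<^sub>m n)"
  shows "b = a"
proof -
  obtain v where v: "v \<in> carrier_vec n" "v \<noteq> 0\<^sub>v n" "(a \<cdot>\<^sub>m 1\<^sub>m n) *\<^sub>v v = b \<cdot>\<^sub>v v"
    using assms unfolding spectrum_def eigenvalue_def eigenvector_def by auto
  obtain i where i: "i < n" "v $ i \<noteq> 0" using v by (metis eq_vecI carrier_vecD index_zero_vec)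
  have "(a \<cdot>\<^sub>m 1\<^sub>m n) *\<^sub>v v = a \<cdot>\<^sub>v v" using v(1) by (intro eq_vecI) auto
  then have "a * v $ i = b * v $ i" using v i by (metis index_smult_vec(1) carrier_vecD)
  then show ?thesis using i by simp
qed

lemma spectrum_diagonal_mat:
  fixes J :: "'a :: field mat"
  assumes J: "J \<in> carrier_mat n n" "diagonal_mat J"
  shows "spectrum J = (\<lambda>i. J $$ (i, i)) ` {..<n}"
proof -
  have Jv: "(J *\<^sub>v v) $ i = J $$ (i, i) * v $ i" if "v \<in> carrier_vec n" "i < n" for v i
  proof -
    have "(J *\<^sub>v v) $ i = (\<Sum>k<n. J $$ (i, k) * v $ k)" using J that by (simp add: scalar_prod_def atLeast0LessThan)
    also have "\<dots> = (\<Sum>k<n. if k = i then J $$ (i, i) * v $ i else 0)"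
      using J that by (intro sum.cong) (auto simp: diagonal_mat_def)
    finally show ?thesis using that by simp
  qed
  show ?thesis
  proof (intro equalityI subsetI)
    fix b assume "b \<in> spectrum J"
    then obtain v where v: "v \<in> carrier_vec n" "v \<noteq> 0\<^sub>v n" "J *\<^sub>v v = b \<cdot>\<^sub>v v"
      using J unfolding spectrum_def eigenvalue_def eigenvector_def by auto
    obtain i where i: "i < n" "v $ i \<noteq> 0" using v by (metis eq_vecI carrier_vecD index_zero_vec)
    then have "J $$ (i, i) = b" using Jv[OF v(1) i(1)] v by simp
    then show "b \<in> (\<lambda>i. J $$ (i, i)) ` {..<n}" using i by auto
  next
    fix b assume "b \<in> (\<lambda>i. J $$ (i, i)) ` {..<n}"
    then obtain i where i: "i < n" "b = J $$ (i, i)" by auto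
    have "J *\<^sub>v unit_vec n i = b \<cdot>\<^sub>v unit_vec n i"
    proof (rule eq_vecI)
      fix k assume "k < dim_vec (b \<cdot>\<^sub>v unit_vec n i)"
      then have k: "k < n" by simp
      show "(J *\<^sub>v unit_vec n i) $ k = (b \<cdot>\<^sub>v unit_vec n i) $ k"
        unfolding Jv[OF unit_vec_carrier k] i(2) using k i(1) by simp
    qed (use J in simp)
    then show "b \<in> spectrum J" using J i unfolding spectrum_def eigenvalue_def eigenvector_def
      by (auto intro!: exI[of _ "unit_vec n i"])
  qed
qed

theorem theorem4p1:
  fixes J :: "'a :: field mat" and n :: nat
  assumes "J \<in> carrier_mat n n"
    and "is_jordan_matrix J"
    and "invertible_mat J"
    and "\<exists>a \<in> spectrum J. \<exists>b \<in> spectrum J. a \<noteq> b"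
    and "mat_trace J = 0"
    and "(\<not> diagonal_mat J \<and> 1 \<notin> spectrum J \<and> -1 \<notin> spectrum J) \<or> diagonal_mat J"
  shows "UL_property J"
proof -
  note J = assms(1)
  have inj: "x = 0\<^sub>v n" if "x \<in> carrier_vec n" "J *\<^sub>v x = 0\<^sub>v n" for x
    using invertible_mat_mult_vec_zero[OF J assms(3) that] .
  have nonscalar: "J \<noteq> a \<cdot>\<^sub>m 1\<^sub>m n" for a using spectrum_of_scalar_mat[of _ a n] assms(4) by blast
  have "J = (J $$ (0, 0)) \<cdot>\<^sub>m 1\<^sub>m n" if "n < 2" using that J by (intro eq_matI) (auto simp: less_2_cases_iff)
  then have n: "n \<ge> 2" using nonscalar by (meson not_le)
  show ?thesis
  proof (cases "\<forall>T :: 'a set. finite T \<longrightarrow> card T \<le> 3 \<longrightarrow> T \<noteq> UNIV")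
    case True
    have "not_outer n J" unfolding not_outer_def
    proof (intro ballI notI)
      fix p q assume pq: "p \<in> carrier_vec n" "q \<in> carrier_vec n" "J = outer_prod n p q"
      \<comment> \<open>A nonzero vector orthogonal to \<open>q\<close>, which exists because
        \<open>n \<ge> 2\<close>; an outer product would kill it, against nonsingularity.\<close>
      define x where "x = (if q $ 0 = 0 then unit_vec n 0 else q $ 1 \<cdot>\<^sub>v unit_vec n 0 - q $ 0 \<cdot>\<^sub>v unit_vec n 1)"
      have x: "x \<in> carrier_vec n" by (simp add: x_def)
      have "q \<bullet> x = 0" using pq(2) n by (auto simp: x_def scalar_prod_minus_distrib[of _ n])
      then have "J *\<^sub>v x = 0\<^sub>v n" using pq x by (auto simp: outer_prod_mult_vec)
      then have "x = 0\<^sub>v n" using inj x by blast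
      moreover have "x $ 0 \<noteq> 0 \<or> x $ 1 \<noteq> 0" using n by (auto simp: x_def)
      ultimately show False using n by auto
    qed
    \<comment> \<open>The induction allows any nonzero column and row; \<open>e_0\<close> is taken
      for both.\<close>
    then have "rooted n J (unit_vec n 0) (unit_vec n 0)"
      using True n J assms(5) nonscalar unit_vec_nonzero[of 0 n, where 'a = 'a]
      by (intro rooted_of_trace_zero) auto
    then show ?thesis using rooted_imp_UL_property[OF J] by blast
  next
    case False
    then have small: "(x :: 'a) \<in> {0, 1, -1}" for x by (metis small_field_cases)
    have "0 \<notin> spectrum J"
    proof
      assume "0 \<in> spectrum J"
      then obtain v where "v \<in> carrier_vec n" "v \<noteq> 0\<^sub>v n" "J *\<^sub>v v = 0 \<cdot>\<^sub>v v"
        using J unfolding spectrum_def eigenvalue_def eigenvector_def by auto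
      moreover from this have "0 \<cdot>\<^sub>v v = 0\<^sub>v n" by (intro eq_vecI) auto
      ultimately show False using inj[of v] by simp
    qed
    then have sub: "spectrum J \<subseteq> {1, -1}" using small by (metis insert_iff subsetI)
    \<comment> \<open>Two distinct eigenvalues within {1, -1} force both to occur, and this leaves
      only the diagonal alternative of the hypothesis.\<close>
    obtain a b where ab: "a \<in> spectrum J" "b \<in> spectrum J" "a \<noteq> b" using assms(4) by blast
    have n11: "(1 :: 'a) \<noteq> -1" using sub ab by (metis insert_iff singletonD subsetD)
    have sp: "spectrum J = {1, -1}" using sub ab by blast
    then have diag: "diagonal_mat J" using assms(6) by auto
    \<comment> \<open>Of the three possible values 0, 1 and -1 for \<open>1 + 1\<close>, only -1
      remains, so the characteristic is three.\<close>
    have "(1 :: 'a) + 1 \<noteq> 0" using n11 by (metis add_eq_0_iff)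
    moreover have "(1 :: 'a) + 1 \<noteq> 1" by (metis add_cancel_right_right one_neq_zero)
    ultimately have "(1 :: 'a) + 1 = -1" using small[of "1 + 1"] by blast
    then have three: "(1 :: 'a) + 1 + 1 = 0" by simp
    define ds where "ds = map (\<lambda>i. J $$ (i, i)) [0..<n]"
    have "J = mat_diag n ((!) ds)"
      using J diag by (intro eq_matI) (auto simp: mat_diag_def ds_def diagonal_mat_def)
    moreover have "set ds = {1, -1}" using sp spectrum_diagonal_mat[OF J diag] by (auto simp: ds_def atLeast0LessThan)
    moreover have "sum_list ds = 0" using assms(5) J by (simp add: ds_def mat_trace_def sum_list_sum_nth atLeast0LessThan)
    moreover have "length ds = n" by (simp add: ds_def)
    ultimately show ?thesis using rooted_signs[OF three] rooted_imp_UL_property[OF J] by metis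
  qed
qed

end
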